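(* Let $\psi(z)=z^2$ and $d=2$. Suppose that $\boldsymbol f_*\in\mathcal{F}^{\mathrm L}_{\mathrm{INV}}$ and that the following assumption holds: there exist an estimator $\hat{\boldsymbol f}_n^{(1)}:I^2\to I^2$ and $C>0$ such that $$\mathbb{P}\Big(\|\hat{\boldsymbol f}_n^{(1)}-\boldsymbol f_*\|_{L^\infty}\le C\,n^{-1/(2+d)}(\log n)^{\alpha}\Big)\ge 1-\delta_n$$ holds for sufficiently large $n$, with some $\alpha>0$ and a sequence $\delta_n\searrow0$ as $n\to\infty$. Then, for any $\beta>0$, there exists $\overline{C}\in(0,\infty)$ such that $$\inf_{\bar{\boldsymbol f}_n}\ \sup_{\boldsymbol f_*\in\mathcal{F}^{\mathrm L}_{\mathrm{INV}}\cap\mathcal{F}^{\mathrm L}(2^{1/4})}\ \mathsf{R}_{\mathrm{INV}}(\bar{\boldsymbol f}_n,\boldsymbol f_* )\ \le\ \overline{C}\,n^{-2/(2+d)}(\log n)^{2\alpha+2\beta}$$ holds for any sufficiently large $n$, where the infimum is taken over all measurable estimators depending on $\mathcal{D}_n$.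
   Context: Let $d=2$ and $I=[-1,1]$. $\mathcal{F}^{\mathrm L}_{\mathrm{INV}}$ is the set of functions $\boldsymbol f:I^2\to I^2$ such that for every $\boldsymbol y\in I^2$ there is a unique $\boldsymbol x\in I^2$ with $\boldsymbol f(\boldsymbol x)=\boldsymbol y$, and that are bi-Lipschitz, i.e. there is some $L\ge 1$ with $L^{-1}\|\boldsymbol x-\boldsymbol x'\|_2\le\|\boldsymbol f(\boldsymbol x)-\boldsymbol f(\boldsymbol x')\|_2\le L\|\boldsymbol x-\boldsymbol x'\|_2$ for all $\boldsymbol x,\boldsymbol x'\in I^2$. Further, $\mathcal{F}^{\mathrm L}(L)=\{\boldsymbol f:I^2\to I^2\mid \boldsymbol f,\boldsymbol f^{-1}\text{ are }L\text{-Lipschitz}\}$. Model: the observations $\mathcal{D}_n=\{(\boldsymbol X_i,\boldsymbol Y_i)\}_{i=1}^n\subset I^2\times\mathbb{R}^2$ are i.i.d. and follow $\boldsymbol Y_i=\boldsymbol f_*(\boldsymbol X_i)+\boldsymbol\varepsilon_i$, with $\boldsymbol\varepsilon_i\sim N_2(\boldsymbol 0,\sigma^2\boldsymbol I_2)$ i.i.d., $\sigma^2>0$, where $\boldsymbol f_*\in\mathcal{F}^{\mathrm L}_{\mathrm{INV}}$ is the true function. The marginal measure $P_{\boldsymbol X}$ of $\boldsymbol X_i$ has a density that is positive and bounded on $I^2$. $\mathbb{E}_n$ is the expectation with respect to $\mathcal{D}_n$. For an estimator $\bar{\boldsymbol f}_n$, its quasi-inverse is defined for $\boldsymbol y\in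 I^2$ by $\bar{\boldsymbol f}_n^{\ddagger}(\boldsymbol y)=\boldsymbol x$ if $\boldsymbol x\in I^2$ is the unique point with $\bar{\boldsymbol f}_n(\boldsymbol x)=\boldsymbol y$, and $\bar{\boldsymbol f}_n^{\ddagger}(\boldsymbol y)=\boldsymbol c$ otherwise, where $\boldsymbol c\in\mathbb{R}^2\setminus I^2$ is some constant vector. For vector-valued $\boldsymbol f=(f_1,f_2)$ on $I^2$, $\|\boldsymbol f\|_{L^\infty}=\max_j\sup_{\boldsymbol x}|f_j(\boldsymbol x)|$ and $\|\boldsymbol f\|_{L^2(P_{\boldsymbol X})}=(\sum_{j=1}^2\int|f_j|^2\,dP_{\boldsymbol X})^{1/2}$. The inverse risk with penalty function $\psi$ is $$\mathsf{R}_{\mathrm{INV}}(\bar{\boldsymbol f}_n,\boldsymbol f_* )=\mathbb{E}_n\Big[\|\bar{\boldsymbol f}_n-\boldsymbol f_*\|_{L^2(P_{\boldsymbol X})}^2+\psi\big(\|\bar{\boldsymbol f}_n^{\ddagger}-\boldsymbol f_*^{-1}\|_{L^2(P_{\boldsymbol X})}\big)\Big].$$ *)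

theory Defs
  imports "HOL-Probability.Probability"
begin

definition I2 :: "(real^2) set" where
  "I2 = {x. \<forall>j. x $ j \<in> {-1..1}}"

text \<open>Functions on the square are total functions on \<^typ>\<open>real^2\<close>; everything below depends
  only on their values on \<^const>\<open>I2\<close>.\<close>

definition F_INV :: "(real^2 \<Rightarrow> real^2) set" where
  "F_INV = {f. f \<in> I2 \<rightarrow> I2 \<and> (\<forall>y\<in>I2. \<exists>!x. x \<in> I2 \<and> f x = y) \<and>
     (\<exists>L\<ge>1. \<forall>x\<in>I2. \<forall>x'\<in>I2.
        inverse L * norm (x - x') \<le> norm (f x - f x') \<and>
        norm (f x - f x') \<le> L * norm (x - x'))}"

definition F_Lip :: "real \<Rightarrow> (real^2 \<Rightarrow> real^2) set" where
  "F_Lip L = {f. bij_betw f I2 I2 \<and> L-lipschitz_on I2 f \<and> L-lipschitz_on I2 (the_inv_into I2 f)}"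

definition quasi_inverse :: "real^2 \<Rightarrow> (real^2 \<Rightarrow> real^2) \<Rightarrow> real^2 \<Rightarrow> real^2" where
  "quasi_inverse c g y =
     (if \<exists>!x. x \<in> I2 \<and> g x = y then THE x. x \<in> I2 \<and> g x = y else c)"

text \<open>Norms take values in \<^typ>\<open>ennreal\<close>, so that no function gets a spurious finite norm.\<close>

definition Linf_norm :: "(real^2 \<Rightarrow> real^2) \<Rightarrow> ennreal" where
  "Linf_norm f = (MAX j. SUP x\<in>I2. ennreal \<bar>f x $ j\<bar>)"

definition ennreal_sqrt :: "ennreal \<Rightarrow> ennreal" where
  "ennreal_sqrt z = (if z = top then top else ennreal (sqrt (enn2real z)))"

definition L2_norm_on :: "(real^2) measure \<Rightarrow> (real^2 \<Rightarrow> real^2) \<Rightarrow> ennreal" where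
  "L2_norm_on P f = ennreal_sqrt (\<Sum>j\<in>UNIV. \<integral>\<^sup>+ x. ennreal (\<bar>f x $ j\<bar>\<^sup>2) \<partial>P)"

definition PX :: "(real^2 \<Rightarrow> real) \<Rightarrow> (real^2) measure" where
  "PX p = density (restrict_space lborel I2) (\<lambda>x. ennreal (p x))"

definition noise :: "real \<Rightarrow> (real^2) measure" where
  "noise \<sigma> = density lborel (\<lambda>e. ennreal (\<Prod>j\<in>UNIV. normal_density 0 \<sigma> (e $ j)))"

abbreviation obs_algebra :: "((real^2) \<times> (real^2)) measure" where
  "obs_algebra \<equiv> restrict_space borel I2 \<Otimes>\<^sub>M borel"

text \<open>Law of one observation \<open>(X, f X + \<epsilon>)\<close> with \<open>X\<close> and \<open>\<epsilon>\<close> independent, and law of the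
  sample of \<open>n\<close> independent copies.\<close>

definition obs_law ::
    "(real^2 \<Rightarrow> real) \<Rightarrow> real \<Rightarrow> (real^2 \<Rightarrow> real^2) \<Rightarrow> ((real^2) \<times> (real^2)) measure" where
  "obs_law p \<sigma> f = distr (PX p \<Otimes>\<^sub>M noise \<sigma>) obs_algebra (\<lambda>(x, e). (x, f x + e))"

definition sample_law ::
    "(real^2 \<Rightarrow> real) \<Rightarrow> real \<Rightarrow> nat \<Rightarrow> (real^2 \<Rightarrow> real^2) \<Rightarrow> (nat \<Rightarrow> (real^2) \<times> (real^2)) measure"
  where "sample_law p \<sigma> n f = PiM {1..n} (\<lambda>_. obs_law p \<sigma> f)"

type_synonym estimator = "(nat \<Rightarrow> (real^2) \<times> (real^2)) \<Rightarrow> real^2 \<Rightarrow> real^2"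

definition estimators :: "nat \<Rightarrow> estimator set" where
  "estimators n = {g. (\<lambda>(D, x). g D x) \<in>
     (PiM {1..n} (\<lambda>_. obs_algebra) \<Otimes>\<^sub>M restrict_space borel I2) \<rightarrow>\<^sub>M borel}"

text \<open>The quasi-inverse of a jointly Borel estimator is in general only universally measurable
  (the set of points with exactly one preimage is coanalytic). Since
  \<open>nn_integral_completion\<close> holds without any measurability assumption, the two
  nonnegative integrals below are nevertheless the integrals with respect to the completed
  measures.\<close>

definition inverse_risk ::
    "(ennreal \<Rightarrow> ennreal) \<Rightarrow> (real^2 \<Rightarrow> real) \<Rightarrow> real \<Rightarrow> real^2 \<Rightarrow> nat \<Rightarrow> estimator \<Rightarrow>
     (real^2 \<Rightarrow> real^2) \<Rightarrow> ennreal" where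
  "inverse_risk \<psi> p \<sigma> c n g f =
     (\<integral>\<^sup>+ D. (L2_norm_on (PX p) (\<lambda>x. g D x - f x))\<^sup>2
           + \<psi> (L2_norm_on (PX p) (\<lambda>y. quasi_inverse c (g D) y - the_inv_into I2 f y))
        \<partial>sample_law p \<sigma> n f)"

text \<open>Probability of an event under the completed sample law: the supremum over \<^const>\<open>I2\<close> makes
  the events of interest universally measurable, but in general not Borel.\<close>

definition sample_prob ::
    "(real^2 \<Rightarrow> real) \<Rightarrow> real \<Rightarrow> nat \<Rightarrow> (real^2 \<Rightarrow> real^2) \<Rightarrow>
     ((nat \<Rightarrow> (real^2) \<times> (real^2)) \<Rightarrow> bool) \<Rightarrow> real" where
  "sample_prob p \<sigma> n f E =
     measure (completion (sample_law p \<sigma> n f)) {D \<in> space (sample_law p \<sigma> n f). E D}"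

end

theory Submission
  imports Defs "HOL-Real_Asymp.Real_Asymp"
begin

text \<open>The rate \<open>\<delta>\<close> may be arbitrarily slow, so the given estimator cannot be used directly: its failure
  event could dominate the risk. It is only used as a witness that the design is not too sparse. If
  it can tell the identity from the identity plus a small bump supported in a ball, then a
  chi-square argument shows that the ball has enough mass under the design distribution, at every
  location and at a scale only slightly larger than the rate. Local averages over the cells of a
  grid of that scale then have mean squared error of the order of the squared scale. Projecting
  the vector of local averages onto a finite net of the function class yields an invertible
  estimator, and the inverse Lipschitz condition transfers its grid error to the error of the
  inverse. The factor \<open>(log n)\<^sup>\<beta>\<close> absorbs all constants in the choice of the scale.\<close>

subsection \<open>Product measures and finite minimisation\<close>

text \<open>The design density is positive but may have infimum zero, so the mass q of a small ball,
  and with it the variance of order 1/(n q) of a local average, has no a priori control. The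
  two-point argument supplies exactly what is missing: n q \<rho>^2 is bounded below by a constant
  for every ball of radius \<rho> around a grid point. Hence the variance is at most a constant
  times \<rho>^2, the order of the squared bias of a Lipschitz function over the ball. The grid has
  at most \<rho>^(-2) points, each responsible for an area of order \<rho>^2, so the integrated
  squared error is again of order \<rho>^2. Local averages alone do not define an invertible map,
  which forces the projection. Its error is controlled deterministically by the distances from the
  averages to the truth and from the net to the truth, so the cardinality of the net never enters
  the risk. The confidence of the given estimator enters only through the level 3/4.\<close>

lemma PiM_density:
  assumes I: "finite I" and M: "prob_space M" and \<phi>: "\<phi> \<in> borel_measurable M"
    and N: "prob_space (density M \<phi>)"
  shows "PiM I (\<lambda>_. density M \<phi>) = density (PiM I (\<lambda>_. M)) (\<lambda>\<omega>. \<Prod>i\<in>I. \<phi> (\<omega> i))"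
proof -
  interpret M: product_prob_space "\<lambda>_. M" I
    by (intro product_prob_spaceI M)
  interpret N: product_prob_space "\<lambda>_. density M \<phi>" I
    by (intro product_prob_spaceI N)
  note [measurable] = \<phi>
  show ?thesis
  proof (rule sym, rule N.PiM_eqI)
    show "sets (density (PiM I (\<lambda>_. M)) (\<lambda>\<omega>. \<Prod>i\<in>I. \<phi> (\<omega> i))) = sets (PiM I (\<lambda>_. density M \<phi>))"
      by (simp cong: sets_PiM_cong)
    show "emeasure (density (PiM I (\<lambda>_. M)) (\<lambda>\<omega>. \<Prod>i\<in>I. \<phi> (\<omega> i))) (Pi\<^sub>E I A)
        = (\<Prod>i\<in>I. emeasure (density M \<phi>) (A i))"
      if A: "\<And>i. i \<in> I \<Longrightarrow> A i \<in> sets (density M \<phi>)" for A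
    proof -
      have A': "A i \<in> sets M" if "i \<in> I" for i
        using A[OF that] by simp
      have "emeasure (density (PiM I (\<lambda>_. M)) (\<lambda>\<omega>. \<Prod>i\<in>I. \<phi> (\<omega> i))) (Pi\<^sub>E I A)
        = (\<integral>\<^sup>+\<omega>. (\<Prod>i\<in>I. \<phi> (\<omega> i)) * indicator (Pi\<^sub>E I A) \<omega> \<partial>PiM I (\<lambda>_. M))"
        using A' I by (intro emeasure_density) (auto intro!: sets_PiM_I_finite)
      also have "\<dots> = (\<integral>\<^sup>+\<omega>. (\<Prod>i\<in>I. \<phi> (\<omega> i) * indicator (A i) (\<omega> i)) \<partial>PiM I (\<lambda>_. M))"
      proof (intro nn_integral_cong)
        fix \<omega> assume "\<omega> \<in> space (PiM I (\<lambda>_. M))"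
        then have "indicator (Pi\<^sub>E I A) \<omega> = (\<Prod>i\<in>I. indicator (A i) (\<omega> i) :: ennreal)"
          using I by (auto simp: space_PiM PiE_iff indicator_def prod_zero_iff)
        then show "(\<Prod>i\<in>I. \<phi> (\<omega> i)) * indicator (Pi\<^sub>E I A) \<omega>
          = (\<Prod>i\<in>I. \<phi> (\<omega> i) * indicator (A i) (\<omega> i))"
          by (simp add: prod.distrib)
      qed
      also have "\<dots> = (\<Prod>i\<in>I. \<integral>\<^sup>+x. \<phi> x * indicator (A i) x \<partial>M)"
        using A' I by (intro M.product_nn_integral_prod) auto
      also have "\<dots> = (\<Prod>i\<in>I. emeasure (density M \<phi>) (A i))"
        using A' by (intro prod.cong) (auto simp: emeasure_density)
      finally show ?thesis .
    qed
  qed (use I in auto)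
qed

text \<open>Independence and centring kill the off-diagonal terms of the expanded square; each
  diagonal term contributes one second moment.\<close>

lemma PiM_integral_sum_squared:
  fixes W :: "'a \<Rightarrow> real"
  assumes I: "finite I" and M: "prob_space M"
    and W: "integrable M W" "integral\<^sup>L M W = 0" "integrable M (\<lambda>x. (W x)\<^sup>2)"
  shows "has_bochner_integral (PiM I (\<lambda>_. M)) (\<lambda>\<omega>. (\<Sum>i\<in>I. W (\<omega> i))\<^sup>2)
    (card I * (\<integral>x. (W x)\<^sup>2 \<partial>M))"
proof -
  interpret M: product_prob_space "\<lambda>_. M" I
    by (intro product_prob_spaceI M)
  \<comment> \<open>\<open>F\<close> rewrites \<open>W (\<omega> i) * W (\<omega> j)\<close> as a
    product over all coordinates. The two factors meet in one coordinate when i = j and give the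
    square there, so the product formula treats diagonal and off-diagonal terms at once.\<close>
  define F where "F i j l = (\<lambda>x. (if l = i then W x else 1) * (if l = j then W x else 1))" for i j l :: 'b
  have int: "integrable M (F i j l)" for i j l
    using W(1,3) by (cases "l = i"; cases "l = j") (auto simp: F_def power2_eq_square)
  have F_int: "integral\<^sup>L M (F i j l) =
      (if l = i \<and> l = j then \<integral>x. (W x)\<^sup>2 \<partial>M else if l = i \<or> l = j then 0 else 1)" for i j l
    using W(2) by (auto simp: F_def power2_eq_square M.M.prob_space)
  have prod: "(\<Prod>l\<in>I. F i j l (\<omega> l)) = W (\<omega> i) * W (\<omega> j)" if "i \<in> I" "j \<in> I" for i j \<omega>
    using that I by (simp add: F_def prod.distrib prod.delta)
  have "has_bochner_integral (PiM I (\<lambda>_. M)) (\<lambda>\<omega>. W (\<omega> i) * W (\<omega> j))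
      (if i = j then \<integral>x. (W x)\<^sup>2 \<partial>M else 0)" if ij: "i \<in> I" "j \<in> I" for i j
  proof -
    have "has_bochner_integral (PiM I (\<lambda>_. M)) (\<lambda>\<omega>. \<Prod>l\<in>I. F i j l (\<omega> l)) (\<Prod>l\<in>I. integral\<^sup>L M (F i j l))"
      unfolding has_bochner_integral_iff
      using M.product_integrable_prod[OF I int] M.product_integral_prod[OF I int] by auto
    moreover have "(\<Prod>l\<in>I. integral\<^sup>L M (F i j l)) = (if i = j then \<integral>x. (W x)\<^sup>2 \<partial>M else 0)"
    proof (cases "i = j")
      case True
      then have "integral\<^sup>L M (F i j l) = (if l = j then \<integral>x. (W x)\<^sup>2 \<partial>M else 1)" for l
        by (auto simp: F_int)
      then show ?thesis
        using True I ij by (simp add: prod.delta)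
    next
      case False
      then show ?thesis
        using I ij by (auto simp: F_int intro!: bexI[of _ i])
    qed
    ultimately show ?thesis
      by (simp add: prod[OF ij])
  qed
  then have "has_bochner_integral (PiM I (\<lambda>_. M)) (\<lambda>\<omega>. \<Sum>i\<in>I. \<Sum>j\<in>I. W (\<omega> i) * W (\<omega> j))
      (\<Sum>i\<in>I. \<Sum>j\<in>I. if i = j then \<integral>x. (W x)\<^sup>2 \<partial>M else 0)"
    by (intro has_bochner_integral_sum)
  then show ?thesis
    using I by (simp add: power2_eq_square sum_product)
qed

text \<open>Bias-variance decomposition around the true mean, with the variance bounded by the raw
  second moment \<open>V\<close>.\<close>

lemma PiM_sample_mean_squared_error:
  fixes Z :: "'a \<Rightarrow> real"
  assumes I: "finite I" "I \<noteq> {}" and M: "prob_space M"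
    and Z: "integrable M Z" "integrable M (\<lambda>x. (Z x)\<^sup>2)"
    and V: "(\<integral>x. (Z x)\<^sup>2 \<partial>M) \<le> V" and b: "\<bar>integral\<^sup>L M Z - a\<bar> \<le> b"
  shows "(\<integral>\<^sup>+\<omega>. ennreal (((\<Sum>i\<in>I. Z (\<omega> i)) / card I - a)\<^sup>2) \<partial>PiM I (\<lambda>_. M)) \<le> ennreal (V / card I + b\<^sup>2)"
proof -
  interpret prob_space M by fact
  define \<mu> where "\<mu> = integral\<^sup>L M Z"
  define n where "n = real (card I)"
  define W where "W x = Z x - \<mu>" for x
  interpret P: product_prob_space "\<lambda>_. M" I
    by (intro product_prob_spaceI M)
  have n: "n > 0"
    using I by (simp add: n_def card_gt_0_iff)
  have W: "integrable M W" "integral\<^sup>L M W = 0" "integrable M (\<lambda>x. (W x)\<^sup>2)"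
    using Z by (auto simp: W_def[abs_def] \<mu>_def prob_space power2_diff)
  have "(\<integral>x. (W x)\<^sup>2 \<partial>M) \<le> (\<integral>x. (Z x)\<^sup>2 \<partial>M)"
    using Z by (simp add: W_def \<mu>_def variance_eq)
  then have WV: "(\<integral>x. (W x)\<^sup>2 \<partial>M) \<le> V"
    using V by simp
  have W_prod: "integrable (PiM I (\<lambda>_. M)) (\<lambda>\<omega>. \<Sum>i\<in>I. W (\<omega> i))"
       "(\<integral>\<omega>. (\<Sum>i\<in>I. W (\<omega> i)) \<partial>PiM I (\<lambda>_. M)) = 0"
  proof -
    have 1: "integrable (PiM I (\<lambda>_. M)) (\<lambda>\<omega>. W (\<omega> i))"
       "(\<integral>\<omega>. W (\<omega> i) \<partial>PiM I (\<lambda>_. M)) = 0" if "i \<in> I" for i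
    proof -
      have int: "integrable M (\<lambda>x. if j = i then W x else 1)" for j
        using W by (cases "j = i") auto
      have "(\<integral>x. (if j = i then W x else 1) \<partial>M) = (if j = i then 0 else 1)" for j
        using W by (simp add: prob_space)
      then show "integrable (PiM I (\<lambda>_. M)) (\<lambda>\<omega>. W (\<omega> i))"
        "(\<integral>\<omega>. W (\<omega> i) \<partial>PiM I (\<lambda>_. M)) = 0"
        using P.product_integrable_prod[of I "\<lambda>j x. if j = i then W x else 1"]
          P.product_integral_prod[of I "\<lambda>j x. if j = i then W x else 1"] int I that
        by (simp_all add: prod.delta)
    qed
    then show "integrable (PiM I (\<lambda>_. M)) (\<lambda>\<omega>. \<Sum>i\<in>I. W (\<omega> i))"
      "(\<integral>\<omega>. (\<Sum>i\<in>I. W (\<omega> i)) \<partial>PiM I (\<lambda>_. M)) = 0"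
      by auto
  qed
  have W2: "has_bochner_integral (PiM I (\<lambda>_. M)) (\<lambda>\<omega>. (\<Sum>i\<in>I. W (\<omega> i))\<^sup>2) (n * (\<integral>x. (W x)\<^sup>2 \<partial>M))"
    unfolding n_def by (rule PiM_integral_sum_squared[OF I(1) M W])
  have expand: "((\<Sum>i\<in>I. Z (\<omega> i)) / n - a)\<^sup>2 =
     (\<Sum>i\<in>I. W (\<omega> i))\<^sup>2 / n\<^sup>2 + 2 * (\<mu> - a) / n * (\<Sum>i\<in>I. W (\<omega> i)) + (\<mu> - a)\<^sup>2" for \<omega>
  proof -
    have "(\<Sum>i\<in>I. Z (\<omega> i)) = (\<Sum>i\<in>I. W (\<omega> i)) + n * \<mu>"
      by (simp add: W_def n_def sum_subtractf)
    then have "(\<Sum>i\<in>I. Z (\<omega> i)) / n - a = (\<Sum>i\<in>I. W (\<omega> i)) / n + (\<mu> - a)"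
      using n by (simp add: field_simps)
    then show ?thesis
      by (simp only: power2_sum power_divide) (simp add: algebra_simps)
  qed
  have "has_bochner_integral (PiM I (\<lambda>_. M)) (\<lambda>\<omega>. ((\<Sum>i\<in>I. Z (\<omega> i)) / n - a)\<^sup>2)
    (n * (\<integral>x. (W x)\<^sup>2 \<partial>M) / n\<^sup>2 + 2 * (\<mu> - a) / n * 0 + (\<mu> - a)\<^sup>2)"
    unfolding expand
    using W2 W_prod P.P.prob_space
    by (auto simp: has_bochner_integral_iff simp del: power2_diff)
  then have "(\<integral>\<^sup>+\<omega>. ennreal (((\<Sum>i\<in>I. Z (\<omega> i)) / n - a)\<^sup>2) \<partial>PiM I (\<lambda>_. M))
      = ennreal ((\<integral>x. (W x)\<^sup>2 \<partial>M) / n + (\<mu> - a)\<^sup>2)"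
    using n by (subst nn_integral_eq_integral) (auto simp: has_bochner_integral_iff power2_eq_square)
  also have "\<dots> \<le> ennreal (V / n + b\<^sup>2)"
    using WV n b power_mono[OF b, of 2] unfolding \<mu>_def
    by (intro ennreal_leI add_mono divide_right_mono) auto
  finally show ?thesis
    by (simp add: n_def)
qed

text \<open>By Cauchy-Schwarz the squared mass of \<open>B\<close> under the second law is at most
  its mass under the first law times the second moment of the density, whence (3/4)^2 / (1/4) = 9/4.
  The inequality is used in a linearised pointwise form, which also copes with infinite values of
  the density.\<close>

lemma two_point_second_moment:
  assumes M: "prob_space M" and \<Lambda>[measurable]: "\<Lambda> \<in> borel_measurable M"
    and B: "B \<in> sets M" "emeasure M B \<le> ennreal (1/4)" "ennreal (3/4) \<le> emeasure (density M \<Lambda>) B"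
  shows "ennreal (9/4) \<le> (\<integral>\<^sup>+x. (\<Lambda> x)\<^sup>2 \<partial>M)"
proof -
  \<comment> \<open>This is (r - 3)^2 \<ge> 0. The tangent point 3 = (3/4) / (1/4) is the constant
    value of the density on \<open>B\<close> in the extremal case, so no constant is lost.\<close>
  have amgm: "\<Lambda> x \<le> ennreal (3/2) + ennreal (1/6) * (\<Lambda> x)\<^sup>2" for x
  proof (cases "\<Lambda> x")
    case (real r)
    have "r \<le> 3/2 + 1/6 * r\<^sup>2"
      using zero_le_power2[of "r - 3"] by (simp add: power2_diff)
    then show ?thesis
      using real by (simp add: ennreal_power flip: ennreal_mult ennreal_plus)
  next
    case top
    then show ?thesis
      by (simp add: power2_eq_square ennreal_mult_top)
  qed
  have "ennreal (3/4) \<le> (\<integral>\<^sup>+x. \<Lambda> x * indicator B x \<partial>M)"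
    using B by (simp add: emeasure_density)
  also have "\<dots> \<le> (\<integral>\<^sup>+x. ennreal (3/2) * indicator B x + ennreal (1/6) * (\<Lambda> x)\<^sup>2 \<partial>M)"
    using amgm by (intro nn_integral_mono) (auto simp: indicator_def)
  also have "\<dots> = ennreal (3/2) * emeasure M B + ennreal (1/6) * (\<integral>\<^sup>+x. (\<Lambda> x)\<^sup>2 \<partial>M)"
    using B by (simp add: nn_integral_add nn_integral_cmult)
  also have "\<dots> \<le> ennreal (3/2) * ennreal (1/4) + ennreal (1/6) * (\<integral>\<^sup>+x. (\<Lambda> x)\<^sup>2 \<partial>M)"
    using B by (intro add_mono mult_left_mono) auto
  finally have *: "ennreal (3/4) \<le> ennreal (3/2) * ennreal (1/4) + ennreal (1/6) * (\<integral>\<^sup>+x. (\<Lambda> x)\<^sup>2 \<partial>M)" .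
  show ?thesis
  proof (cases "\<integral>\<^sup>+x. (\<Lambda> x)\<^sup>2 \<partial>M")
    case (real r)
    have "3/4 \<le> 3/2 * (1/4) + 1/6 * r"
      using * real by (simp flip: ennreal_mult ennreal_plus del: ennreal_1)
    then show ?thesis
      using real by (simp add: ennreal_leI)
  qed simp
qed

text \<open>Ties are broken by the least index in an enumeration of \<open>S\<close>. The choice is
  then a natural number determined by countably many comparisons of measurable scores, and needs no
  sigma-algebra on \<open>S\<close>.\<close>

lemma measurable_finite_argmin:
  fixes score :: "'a \<Rightarrow> 's \<Rightarrow> real"
  assumes S: "finite S" "S \<noteq> {}" and [measurable]: "\<And>s. s \<in> S \<Longrightarrow> (\<lambda>x. score x s) \<in> borel_measurable M"
  obtains e :: "nat \<Rightarrow> 's" and N where "N \<in> M \<rightarrow>\<^sub>M count_space UNIV" "range e \<subseteq> S"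
    "\<And>x s. s \<in> S \<Longrightarrow> score x (e (N x)) \<le> score x s"
proof -
  obtain e :: "nat \<Rightarrow> 's" where e: "range e = S"
    using S by (metis countable_finite uncountable_def)
  have [measurable]: "(\<lambda>x. score x (e i)) \<in> borel_measurable M" for i
    using e by (intro assms) auto
  define N where "N x = (LEAST i. \<forall>s\<in>S. score x (e i) \<le> score x s)" for x
  have "\<exists>i. \<forall>s\<in>S. score x (e i) \<le> score x s" for x
  proof -
    have "arg_min_on (score x) S \<in> S"
      using S by (intro arg_min_if_finite)
    then obtain i where "e i = arg_min_on (score x) S"
      using e by (metis imageE)
    then have "\<forall>s\<in>S. score x (e i) \<le> score x s"
      using S by (simp add: arg_min_least)
    then show ?thesis ..
  qed
  then have *: "\<forall>s\<in>S. score x (e (N x)) \<le> score x s" for x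
    unfolding N_def by (rule LeastI_ex)
  have "N \<in> M \<rightarrow>\<^sub>M count_space UNIV"
    unfolding N_def using S(1) by measurable
  then show ?thesis
    using that e * by blast
qed

subsection \<open>The regression model\<close>

lemma prod_Basis_vec:
  fixes F :: "real^'n \<Rightarrow> 'b::comm_monoid_mult"
  shows "(\<Prod>b\<in>Basis. F b) = (\<Prod>j\<in>UNIV. F (axis j 1))"
proof -
  have B: "(Basis :: (real^'n) set) = range (\<lambda>j. axis j 1)"
    by (auto simp: Basis_vec_def)
  have inj: "inj (\<lambda>j::'n. axis j (1::real))"
    by (auto simp: inj_on_def axis_eq_axis)
  show ?thesis
    unfolding B by (subst prod.reindex[OF inj]) (simp add: o_def)
qed

lemma nn_integral_lborel_vec_prod:
  fixes f :: "'n::finite \<Rightarrow> real \<Rightarrow> ennreal"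
  assumes [measurable]: "\<And>j. f j \<in> borel_measurable borel"
  shows "(\<integral>\<^sup>+x. (\<Prod>j\<in>UNIV. f j (x $ j)) \<partial>(lborel :: (real^'n) measure)) = (\<Prod>j\<in>UNIV. \<integral>\<^sup>+t. f j t \<partial>lborel)"
proof -
  define g where "g b = f (inv (\<lambda>j. axis j 1 :: real^'n) b)" for b
  have g: "g (axis j 1) = f j" for j
    unfolding g_def by (subst inv_f_f) (auto simp: inj_on_def axis_eq_axis)
  show ?thesis
    using nn_integral_lborel_prod[of g] by (simp add: prod_Basis_vec g inner_axis) (simp add: g_def)
qed

lemma nn_integral_lborel_shift:
  fixes v :: "'a::euclidean_space"
  assumes [measurable]: "u \<in> borel_measurable borel"
  shows "(\<integral>\<^sup>+x. u (v + x) \<partial>lborel) = (\<integral>\<^sup>+x. u x \<partial>lborel)"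
proof -
  have "(\<integral>\<^sup>+x. u x \<partial>lborel) = (\<integral>\<^sup>+x. u x \<partial>distr lborel borel (\<lambda>x. v + 1 *\<^sub>R x))"
    using lborel_affine[of 1 v] by (simp add: density_1)
  then show ?thesis
    by (simp add: nn_integral_distr)
qed

section \<open>Gaussian noise in the plane\<close>

definition noise_density :: "real \<Rightarrow> real^2 \<Rightarrow> real" where
  "noise_density \<sigma> e = (\<Prod>j\<in>UNIV. normal_density 0 \<sigma> (e $ j))"

lemma noise_density_measurable [measurable]: "noise_density \<sigma> \<in> borel_measurable borel"
  unfolding noise_density_def[abs_def] by measurable

lemma noise_density_pos: "0 < \<sigma> \<Longrightarrow> 0 < noise_density \<sigma> e"
  by (auto simp: noise_density_def intro!: prod_pos normal_density_pos)

lemma noise_eq: "noise \<sigma> = density lborel (\<lambda>e. ennreal (noise_density \<sigma> e))"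
  by (simp add: noise_def noise_density_def)

lemma sets_noise [measurable_cong, simp]: "sets (noise \<sigma>) = sets borel"
  by (simp add: noise_def)

lemma space_noise [simp]: "space (noise \<sigma>) = UNIV"
  by (simp add: noise_def)

lemma nn_integral_normal_density:
  assumes "0 < \<sigma>" shows "(\<integral>\<^sup>+t. ennreal (normal_density \<mu> \<sigma> t) \<partial>lborel) = 1"
  using prob_space.emeasure_space_1[OF prob_space_normal_density[OF assms, of \<mu>]]
  by (simp add: emeasure_density)

text \<open>The density is a product and its other factor integrates to one. This reduces the
  moments of the planar noise to those of the one-dimensional normal law.\<close>

lemma distr_noise_component:
  assumes "0 < \<sigma>"
  shows "distr (noise \<sigma>) borel (\<lambda>e. e $ j) = density lborel (\<lambda>t. ennreal (normal_density 0 \<sigma> t))"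
proof (rule measure_eqI)
  fix A assume "A \<in> sets (distr (noise \<sigma>) borel (\<lambda>e. e $ j))"
  then have [measurable]: "A \<in> sets borel" by simp
  \<comment> \<open>The event is attached to the factor of coordinate \<open>j\<close> only, so the
    integral is again one of a product.\<close>
  define f where "f i t = ennreal (normal_density 0 \<sigma> t) * (if i = j then indicator A t else 1)" for i t
  have f_meas: "f i \<in> borel_measurable borel" for i
    unfolding f_def[abs_def] by measurable
  have f_int: "(\<integral>\<^sup>+t. f i t \<partial>lborel) =
    (if i = j then \<integral>\<^sup>+t. ennreal (normal_density 0 \<sigma> t) * indicator A t \<partial>lborel else 1)" for i
    by (auto simp: f_def nn_integral_normal_density[OF assms])
  have "emeasure (distr (noise \<sigma>) borel (\<lambda>e. e $ j)) A = (\<integral>\<^sup>+t. indicator A t \<partial>distr (noise \<sigma>) borel (\<lambda>e. e $ j))"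
    by simp
  also have "\<dots> = (\<integral>\<^sup>+e. indicator A (e $ j) \<partial>noise \<sigma>)"
    by (intro nn_integral_distr) auto
  also have "\<dots> = (\<integral>\<^sup>+e. ennreal (noise_density \<sigma> e) * indicator A (e $ j) \<partial>lborel)"
    by (simp add: noise_eq nn_integral_density)
  also have "\<dots> = (\<integral>\<^sup>+e. (\<Prod>i\<in>UNIV. f i (e $ i)) \<partial>lborel)"
    by (intro nn_integral_cong)
      (simp add: f_def prod.distrib noise_density_def prod_ennreal)
  also have "\<dots> = (\<Prod>i\<in>UNIV. \<integral>\<^sup>+t. f i t \<partial>lborel)"
    by (intro nn_integral_lborel_vec_prod f_meas)
  also have "\<dots> = emeasure (density lborel (\<lambda>t. ennreal (normal_density 0 \<sigma> t))) A"
    by (simp add: f_int emeasure_density)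
  finally show "emeasure (distr (noise \<sigma>) borel (\<lambda>e. e $ j)) A
    = emeasure (density lborel (\<lambda>t. ennreal (normal_density 0 \<sigma> t))) A" .
qed simp

text \<open>A push-forward preserves the total mass, so it can be read off from one
  coordinate.\<close>

lemma prob_space_noise:
  assumes "0 < \<sigma>" shows "prob_space (noise \<sigma>)"
proof (rule prob_space_distrD[of "\<lambda>e. e $ 1" _ borel])
  show "prob_space (distr (noise \<sigma>) borel (\<lambda>e. e $ 1))"
    using assms by (simp add: distr_noise_component prob_space_normal_density)
qed simp

lemma noise_moments:
  assumes "0 < \<sigma>"
  shows "integrable (noise \<sigma>) (\<lambda>e. e $ j)" "(\<integral>e. e $ j \<partial>noise \<sigma>) = 0"
    "integrable (noise \<sigma>) (\<lambda>e. (e $ j)\<^sup>2)" "(\<integral>e. (e $ j)\<^sup>2 \<partial>noise \<sigma>) = \<sigma>\<^sup>2"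
proof -
  have int: "integrable (noise \<sigma>) (\<lambda>e. u (e $ j)) \<longleftrightarrow> integrable lborel (\<lambda>t. normal_density 0 \<sigma> t * u t)"
    if [measurable]: "u \<in> borel_measurable borel" for u :: "real \<Rightarrow> real"
    using integrable_distr_eq[of "\<lambda>e. e $ j" "noise \<sigma>" borel u]
    by (simp add: distr_noise_component[OF assms] integrable_density)
  have integral: "(\<integral>e. u (e $ j) \<partial>noise \<sigma>) = (\<integral>t. normal_density 0 \<sigma> t * u t \<partial>lborel)"
    if [measurable]: "u \<in> borel_measurable borel" for u :: "real \<Rightarrow> real"
    using integral_distr[of "\<lambda>e. e $ j" "noise \<sigma>" borel u]
    by (simp add: distr_noise_component[OF assms] integral_density)
  show "integrable (noise \<sigma>) (\<lambda>e. e $ j)" "(\<integral>e. e $ j \<partial>noise \<sigma>) = 0"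
    using int[of "\<lambda>t. t"] integral[of "\<lambda>t. t"] integrable_normal_moment_nz_1[OF assms, of 0]
      integral_normal_moment_nz_1[OF assms, of 0] by auto
  show "integrable (noise \<sigma>) (\<lambda>e. (e $ j)\<^sup>2)" "(\<integral>e. (e $ j)\<^sup>2 \<partial>noise \<sigma>) = \<sigma>\<^sup>2"
    using int[of "\<lambda>t. t\<^sup>2"] integral[of "\<lambda>t. t\<^sup>2"] integrable_normal_moment[OF assms, of 0 2]
      integral_normal_moment_even[OF assms, of 0 1]
    by (auto simp: fact_numeral)
qed

lemma nn_integral_noise_shift:
  assumes [measurable]: "u \<in> borel_measurable borel"
  shows "(\<integral>\<^sup>+e. u (v + e) \<partial>noise \<sigma>) = (\<integral>\<^sup>+y. ennreal (noise_density \<sigma> (y - v)) * u y \<partial>lborel)"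
  using nn_integral_lborel_shift[of "\<lambda>y. ennreal (noise_density \<sigma> (y - v)) * u y" v]
  by (simp add: noise_eq nn_integral_density)

section \<open>The design and the law of one observation\<close>

lemma I2_eq_cbox: "I2 = cbox (\<chi> j. - 1) (\<chi> j. 1)"
  by (auto simp: I2_def mem_box_cart)

lemma I2_closed [simp]: "closed I2"
  unfolding I2_eq_cbox by (rule closed_cbox)

lemma I2_borel [measurable, simp]: "I2 \<in> sets borel"
  by simp

lemma sets_PX [measurable_cong, simp]: "sets (PX p) = sets (restrict_space borel I2)"
  by (simp add: PX_def sets_restrict_space_cong[of lborel borel])

lemma space_PX [simp]: "space (PX p) = I2"
  by (simp add: PX_def space_restrict_space)

lemma nn_integral_indicator_PX_le:
  assumes p_meas: "p \<in> borel_measurable (restrict_space borel I2)"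
    and p_le: "\<And>x. x \<in> I2 \<Longrightarrow> p x \<le> B"
    and A: "A \<in> sets borel"
  shows "(\<integral>\<^sup>+x. indicator A x \<partial>PX p) \<le> ennreal B * emeasure lborel A"
proof -
  have [measurable_cong]: "sets (restrict_space lborel I2) = sets (restrict_space borel I2)"
    by (intro sets_restrict_space_cong) simp
  note [measurable] = p_meas A
  have [measurable]: "indicator A \<in> restrict_space borel I2 \<rightarrow>\<^sub>M (borel :: ennreal measure)"
    by (intro measurable_restrict_space1) simp
  have "(\<integral>\<^sup>+x. indicator A x \<partial>PX p) = (\<integral>\<^sup>+x. ennreal (p x) * indicator A x \<partial>restrict_space lborel I2)"
    unfolding PX_def by (intro nn_integral_density) measurable
  also have "\<dots> \<le> (\<integral>\<^sup>+x. ennreal B * indicator A x \<partial>restrict_space lborel I2)"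
    using p_le by (intro nn_integral_mono mult_right_mono ennreal_leI) (auto simp: space_restrict_space)
  also have "\<dots> = (\<integral>\<^sup>+x. ennreal B * indicator A x * indicator I2 x \<partial>lborel)"
    by (subst nn_integral_restrict_space) auto
  also have "\<dots> \<le> (\<integral>\<^sup>+x. ennreal B * indicator A x \<partial>lborel)"
    by (intro nn_integral_mono) (auto simp: indicator_def)
  also have "\<dots> = ennreal B * emeasure lborel A"
    using A by (simp add: nn_integral_cmult)
  finally show ?thesis .
qed

lemma sets_obs_law [measurable_cong, simp]: "sets (obs_law p \<sigma> f) = sets obs_algebra"
  by (simp add: obs_law_def)

lemma obs_map_measurable:
  assumes [measurable]: "f \<in> restrict_space borel I2 \<rightarrow>\<^sub>M borel"
  shows "(\<lambda>(x, e). (x, f x + e)) \<in> PX p \<Otimes>\<^sub>M noise \<sigma> \<rightarrow>\<^sub>M obs_algebra"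
  by measurable

lemma prob_space_obs_law:
  assumes f: "f \<in> restrict_space borel I2 \<rightarrow>\<^sub>M borel" and "prob_space (PX p)" "0 < \<sigma>"
  shows "prob_space (obs_law p \<sigma> f)"
proof -
  interpret pair_prob_space "PX p" "noise \<sigma>"
    using assms prob_space_noise by (auto simp: pair_prob_space_def pair_sigma_finite_def prob_space_imp_sigma_finite)
  show ?thesis
    unfolding obs_law_def by (intro prob_space_distr obs_map_measurable f)
qed

text \<open>Translating the noise by \<open>f x\<close> moves the regression function from the
  argument into the density. The laws for different regression functions thereby get the same
  reference measure, the design times Lebesgue measure, and can be compared by likelihood
  ratios.\<close>

lemma nn_integral_obs_law:
  assumes f[measurable]: "f \<in> restrict_space borel I2 \<rightarrow>\<^sub>M borel" and \<sigma>: "0 < \<sigma>"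
    and u[measurable]: "u \<in> borel_measurable obs_algebra"
  shows "(\<integral>\<^sup>+z. u z \<partial>obs_law p \<sigma> f) =
    (\<integral>\<^sup>+x. \<integral>\<^sup>+y. ennreal (noise_density \<sigma> (y - f x)) * u (x, y) \<partial>lborel \<partial>PX p)"
proof -
  interpret noise: prob_space "noise \<sigma>"
    using \<sigma> by (rule prob_space_noise)
  note [measurable] = obs_map_measurable[OF f]
  have "(\<integral>\<^sup>+z. u z \<partial>obs_law p \<sigma> f) = (\<integral>\<^sup>+(x, e). u (x, f x + e) \<partial>(PX p \<Otimes>\<^sub>M noise \<sigma>))"
    unfolding obs_law_def by (subst nn_integral_distr) (auto intro!: nn_integral_cong)
  also have "\<dots> = (\<integral>\<^sup>+x. \<integral>\<^sup>+e. u (x, f x + e) \<partial>noise \<sigma> \<partial>PX p)"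
    by (subst noise.nn_integral_fst[symmetric]) auto
  also have "\<dots> = (\<integral>\<^sup>+x. \<integral>\<^sup>+y. ennreal (noise_density \<sigma> (y - f x)) * u (x, y) \<partial>lborel \<partial>PX p)"
  proof (intro nn_integral_cong)
    fix x assume "x \<in> space (PX p)"
    then have x: "x \<in> space (restrict_space borel I2)"
      by (simp add: space_restrict_space)
    have "(\<lambda>y. u (x, y)) \<in> borel_measurable borel"
      by (rule measurable_compose[OF measurable_Pair1'[OF x] u])
    then show "(\<integral>\<^sup>+e. u (x, f x + e) \<partial>noise \<sigma>) = (\<integral>\<^sup>+y. ennreal (noise_density \<sigma> (y - f x)) * u (x, y) \<partial>lborel)"
      by (rule nn_integral_noise_shift)
  qed
  finally show ?thesis .
qed

text \<open>Density of the law under \<open>f'\<close> with respect to the law under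
  \<open>f\<close>. The design density is common to both laws and cancels, and positivity of the
  Gaussian density makes the quotient meaningful everywhere.\<close>

definition likelihood_ratio ::
    "real \<Rightarrow> (real^2 \<Rightarrow> real^2) \<Rightarrow> (real^2 \<Rightarrow> real^2) \<Rightarrow> (real^2) \<times> (real^2) \<Rightarrow> ennreal" where
  "likelihood_ratio \<sigma> f f' = (\<lambda>(x, y). ennreal (noise_density \<sigma> (y - f' x) / noise_density \<sigma> (y - f x)))"

lemma likelihood_ratio_measurable:
  assumes [measurable]: "f \<in> restrict_space borel I2 \<rightarrow>\<^sub>M borel" "f' \<in> restrict_space borel I2 \<rightarrow>\<^sub>M borel"
  shows "likelihood_ratio \<sigma> f f' \<in> borel_measurable obs_algebra"
  unfolding likelihood_ratio_def by measurable

lemma obs_law_eq_density: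
  assumes f: "f \<in> restrict_space borel I2 \<rightarrow>\<^sub>M borel" and f': "f' \<in> restrict_space borel I2 \<rightarrow>\<^sub>M borel"
    and \<sigma>: "0 < \<sigma>"
  shows "obs_law p \<sigma> f' = density (obs_law p \<sigma> f) (likelihood_ratio \<sigma> f f')"
proof (rule measure_eqI)
  fix A assume "A \<in> sets (obs_law p \<sigma> f')"
  then have A[measurable]: "A \<in> sets obs_algebra" by simp
  note [measurable] = likelihood_ratio_measurable[OF f f']
  have "emeasure (obs_law p \<sigma> f') A = (\<integral>\<^sup>+z. indicator A z \<partial>obs_law p \<sigma> f')"
    by simp
  also have "\<dots> = (\<integral>\<^sup>+x. \<integral>\<^sup>+y. ennreal (noise_density \<sigma> (y - f' x)) * indicator A (x, y) \<partial>lborel \<partial>PX p)"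
    by (rule nn_integral_obs_law[OF f' \<sigma>]) measurable
  also have "\<dots> = (\<integral>\<^sup>+x. \<integral>\<^sup>+y. ennreal (noise_density \<sigma> (y - f x)) *
      (likelihood_ratio \<sigma> f f' (x, y) * indicator A (x, y)) \<partial>lborel \<partial>PX p)"
  proof (intro nn_integral_cong)
    fix x y
    have "noise_density \<sigma> (y - f' x) =
      noise_density \<sigma> (y - f x) * (noise_density \<sigma> (y - f' x) / noise_density \<sigma> (y - f x))"
      using noise_density_pos[OF \<sigma>, of "y - f x"] by simp
    then show "ennreal (noise_density \<sigma> (y - f' x)) * indicator A (x, y) = ennreal (noise_density \<sigma> (y - f x)) *
      (likelihood_ratio \<sigma> f f' (x, y) * indicator A (x, y))"
      using noise_density_pos[OF \<sigma>]
      by (simp add: likelihood_ratio_def less_imp_le flip: mult.assoc ennreal_mult)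
  qed
  also have "\<dots> = (\<integral>\<^sup>+z. likelihood_ratio \<sigma> f f' z * indicator A z \<partial>obs_law p \<sigma> f)"
    by (rule nn_integral_obs_law[OF f \<sigma>, symmetric]) measurable
  also have "\<dots> = emeasure (density (obs_law p \<sigma> f) (likelihood_ratio \<sigma> f f')) A"
    by (simp add: emeasure_density)
  finally show "emeasure (obs_law p \<sigma> f') A = emeasure (density (obs_law p \<sigma> f) (likelihood_ratio \<sigma> f f')) A" .
qed simp

text \<open>Completing the square: the quotient is a multiple of the normal density centred at the
  reflection of \<open>a\<close> in \<open>b\<close>. Its integral is therefore the prefactor, which
  is one plus the chi-square divergence of the two normal laws.\<close>

lemma normal_density_square_ratio:
  assumes "0 < \<sigma>"
  shows "(normal_density 0 \<sigma> (t - b))\<^sup>2 / normal_density 0 \<sigma> (t - a)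
    = exp ((a - b)\<^sup>2 / \<sigma>\<^sup>2) * normal_density 0 \<sigma> (t - (2 * b - a))"
proof -
  have "2 * - (t - b)\<^sup>2 / (2 * \<sigma>\<^sup>2) - - (t - a)\<^sup>2 / (2 * \<sigma>\<^sup>2) = (a - b)\<^sup>2 / \<sigma>\<^sup>2 + - (t - (2 * b - a))\<^sup>2 / (2 * \<sigma>\<^sup>2)"
    using assms by (simp add: field_simps power2_eq_square)
  then have "(exp (- (t - b)\<^sup>2 / (2 * \<sigma>\<^sup>2)))\<^sup>2 / exp (- (t - a)\<^sup>2 / (2 * \<sigma>\<^sup>2)) =
    exp ((a - b)\<^sup>2 / \<sigma>\<^sup>2) * exp (- (t - (2 * b - a))\<^sup>2 / (2 * \<sigma>\<^sup>2))"
    by (simp add: exp_double[symmetric] exp_diff[symmetric] exp_add[symmetric])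
  then show ?thesis
    using assms by (simp add: normal_density_def power2_eq_square field_simps)
qed

lemma norm_vec2_power2: "(norm (x :: real^2))\<^sup>2 = (\<Sum>j\<in>UNIV. (x $ j)\<^sup>2)"
  by (simp add: norm_vec_def L2_set_def sum_nonneg)

lemma noise_density_square_ratio:
  assumes "0 < \<sigma>"
  shows "(noise_density \<sigma> (y - b))\<^sup>2 / noise_density \<sigma> (y - a)
    = exp ((norm (a - b))\<^sup>2 / \<sigma>\<^sup>2) * noise_density \<sigma> (y - (2 *\<^sub>R b - a))"
proof -
  have "(noise_density \<sigma> (y - b))\<^sup>2 / noise_density \<sigma> (y - a) =
    (\<Prod>j\<in>UNIV. (normal_density 0 \<sigma> (y $ j - b $ j))\<^sup>2 / normal_density 0 \<sigma> (y $ j - a $ j))"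
    by (simp add: noise_density_def prod_dividef prod_power_distrib)
  also have "\<dots> = (\<Prod>j\<in>UNIV. exp ((a $ j - b $ j)\<^sup>2 / \<sigma>\<^sup>2) * normal_density 0 \<sigma> (y $ j - (2 * b $ j - a $ j)))"
    using assms by (simp add: normal_density_square_ratio)
  also have "\<dots> = exp ((norm (a - b))\<^sup>2 / \<sigma>\<^sup>2) * noise_density \<sigma> (y - (2 *\<^sub>R b - a))"
    by (simp add: prod.distrib noise_density_def norm_vec2_power2 sum_divide_distrib exp_sum)
  finally show ?thesis .
qed

text \<open>Given the design point, the integral over the response is a Gaussian chi-square
  computation. The average over the design is kept, so points where \<open>f\<close> and
  \<open>f'\<close> agree contribute exactly their own mass.\<close>

lemma likelihood_ratio_second_moment:
  assumes f: "f \<in> restrict_space borel I2 \<rightarrow>\<^sub>M borel" and f': "f' \<in> restrict_space borel I2 \<rightarrow>\<^sub>M borel"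
    and \<sigma>: "0 < \<sigma>"
  shows "(\<integral>\<^sup>+z. (likelihood_ratio \<sigma> f f' z)\<^sup>2 \<partial>obs_law p \<sigma> f)
    = (\<integral>\<^sup>+x. ennreal (exp ((norm (f x - f' x))\<^sup>2 / \<sigma>\<^sup>2)) \<partial>PX p)"
proof -
  note [measurable] = likelihood_ratio_measurable[OF f f']
  have "(\<integral>\<^sup>+z. (likelihood_ratio \<sigma> f f' z)\<^sup>2 \<partial>obs_law p \<sigma> f) =
    (\<integral>\<^sup>+x. \<integral>\<^sup>+y. ennreal (noise_density \<sigma> (y - f x)) * (likelihood_ratio \<sigma> f f' (x, y))\<^sup>2 \<partial>lborel \<partial>PX p)"
    by (rule nn_integral_obs_law[OF f \<sigma>]) measurable
  also have "\<dots> = (\<integral>\<^sup>+x. ennreal (exp ((norm (f x - f' x))\<^sup>2 / \<sigma>\<^sup>2)) \<partial>PX p)"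
  proof (intro nn_integral_cong)
    fix x
    define w where "w = 2 *\<^sub>R f' x - f x"
    have pt: "ennreal (noise_density \<sigma> (y - f x)) * (likelihood_ratio \<sigma> f f' (x, y))\<^sup>2
      = ennreal (exp ((norm (f x - f' x))\<^sup>2 / \<sigma>\<^sup>2)) * ennreal (noise_density \<sigma> (y - w))" for y
    proof -
      have "noise_density \<sigma> (y - f x) * (noise_density \<sigma> (y - f' x) / noise_density \<sigma> (y - f x))\<^sup>2 =
        (noise_density \<sigma> (y - f' x))\<^sup>2 / noise_density \<sigma> (y - f x)"
        using noise_density_pos[OF \<sigma>, of "y - f x"] by (simp add: power2_eq_square)
      also have "\<dots> = exp ((norm (f x - f' x))\<^sup>2 / \<sigma>\<^sup>2) * noise_density \<sigma> (y - w)"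
        unfolding w_def by (rule noise_density_square_ratio[OF \<sigma>])
      finally show ?thesis
        using noise_density_pos[OF \<sigma>]
        by (simp add: likelihood_ratio_def less_imp_le ennreal_power flip: ennreal_mult)
    qed
    have "(\<integral>\<^sup>+y. ennreal (noise_density \<sigma> (y - w)) \<partial>lborel) = (\<integral>\<^sup>+y. ennreal (noise_density \<sigma> y) \<partial>lborel)"
      using nn_integral_lborel_shift[of "\<lambda>y. ennreal (noise_density \<sigma> (y - w))" w] by simp
    also have "\<dots> = 1"
      using prob_space.emeasure_space_1[OF prob_space_noise[OF \<sigma>]] by (simp add: noise_eq emeasure_density)
    finally show "(\<integral>\<^sup>+y. ennreal (noise_density \<sigma> (y - f x)) * (likelihood_ratio \<sigma> f f' (x, y))\<^sup>2 \<partial>lborel) =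
      ennreal (exp ((norm (f x - f' x))\<^sup>2 / \<sigma>\<^sup>2))"
      unfolding pt by (simp add: nn_integral_cmult)
  qed
  finally show ?thesis .
qed

subsection \<open>Mass of small balls\<close>

definition inv_class :: "(real^2 \<Rightarrow> real^2) set" where
  "inv_class = F_INV \<inter> F_Lip (2 powr (1/4))"

text \<open>Upper bounds work with the rounded Lipschitz constant 2, which changes only constants in
  the risk.\<close>

lemma lip_const_le_2: "(2::real) powr (1/4) \<le> 2"
  using powr_mono[of "1/4" 1 "2::real"] by simp

text \<open>The fraction 28/25 lies above 11/10 and 10/9, the Lipschitz constants of a perturbation
  of the identity of slope 1/10 and of its inverse, and its fourth power is still below 2. Such
  perturbations therefore stay inside the restricted class.\<close>

lemma lip_const_ge: "28/25 \<le> (2::real) powr (1/4)"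
proof -
  have "(28/25::real) = (28/25) powr (4 * (1/4))"
    by simp
  also have "\<dots> = ((28/25) ^ 4) powr (1/4)"
    by (simp only: powr_powr[symmetric] powr_realpow powr_numeral)
  also have "\<dots> \<le> 2 powr (1/4)"
    by (intro powr_mono2) (auto simp: power4_eq_xxxx)
  finally show ?thesis .
qed

lemma
  assumes "f \<in> inv_class"
  shows inv_class_bij: "bij_betw f I2 I2"
    and inv_class_lipschitz: "\<And>x y. x \<in> I2 \<Longrightarrow> y \<in> I2 \<Longrightarrow> norm (f x - f y) \<le> 2 * norm (x - y)"
    and inv_class_inverse_lipschitz: "\<And>x y. x \<in> I2 \<Longrightarrow> y \<in> I2 \<Longrightarrow>
      norm (the_inv_into I2 f x - the_inv_into I2 f y) \<le> 2 * norm (x - y)"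
    and inv_class_measurable: "f \<in> restrict_space borel I2 \<rightarrow>\<^sub>M borel"
proof -
  have f: "bij_betw f I2 I2" "(2 powr (1/4))-lipschitz_on I2 f" "(2 powr (1/4))-lipschitz_on I2 (the_inv_into I2 f)"
    using assms by (auto simp: inv_class_def F_Lip_def)
  have f2: "2-lipschitz_on I2 f" "2-lipschitz_on I2 (the_inv_into I2 f)"
    using lipschitz_on_le[OF f(2) lip_const_le_2] lipschitz_on_le[OF f(3) lip_const_le_2] by auto
  show "bij_betw f I2 I2" by fact
  show "norm (f x - f y) \<le> 2 * norm (x - y)" if "x \<in> I2" "y \<in> I2" for x y
    using lipschitz_onD[OF f2(1) that] by (simp add: dist_norm)
  show "norm (the_inv_into I2 f x - the_inv_into I2 f y) \<le> 2 * norm (x - y)" if "x \<in> I2" "y \<in> I2" for x y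
    using lipschitz_onD[OF f2(2) that] by (simp add: dist_norm)
  show "f \<in> restrict_space borel I2 \<rightarrow>\<^sub>M borel"
    by (intro borel_measurable_continuous_on_restrict lipschitz_on_continuous_on[OF f2(1)])
qed

lemma inv_class_in_I2: "f \<in> inv_class \<Longrightarrow> x \<in> I2 \<Longrightarrow> f x \<in> I2"
  using inv_class_bij bij_betw_apply by fastforce

lemma inv_class_the_inv:
  assumes "f \<in> inv_class" "y \<in> I2"
  shows "the_inv_into I2 f y \<in> I2" "f (the_inv_into I2 f y) = y"
proof -
  have f: "inj_on f I2" "f ` I2 = I2"
    using inv_class_bij[OF assms(1)] by (auto simp: bij_betw_def)
  show "the_inv_into I2 f y \<in> I2" "f (the_inv_into I2 f y) = y"
    using the_inv_into_into[OF f(1), of y I2] f_the_inv_into_f[OF f(1), of y] f(2) assms(2) by auto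
qed

lemma inv_class_the_inv_apply:
  assumes "f \<in> inv_class" "x \<in> I2" shows "the_inv_into I2 f (f x) = x"
  using inv_class_bij[OF assms(1)] assms(2) by (auto simp: bij_betw_def the_inv_into_f_f)

text \<open>The projected estimator takes all its values in the class, so the default value
  \<open>c\<close> never contributes to its risk.\<close>

lemma quasi_inverse_inv_class:
  assumes f: "f \<in> inv_class" and y: "y \<in> I2"
  shows "quasi_inverse c f y = the_inv_into I2 f y"
proof -
  have "\<exists>!x. x \<in> I2 \<and> f x = y"
    using inv_class_the_inv[OF f y] inv_class_the_inv_apply[OF f] by metis
  then show ?thesis
    by (simp add: quasi_inverse_def the_inv_into_def)
qed

text \<open>A contractive perturbation of the identity is a bijection of the whole plane by Banach's
  fixed point theorem; being the identity off the square, it permutes the square.\<close>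

lemma perturbed_identity_in_inv_class:
  fixes \<phi> :: "real^2 \<Rightarrow> real^2"
  assumes lip: "\<And>x y. norm (\<phi> x - \<phi> y) \<le> norm (x - y) / 10" and supp: "\<And>x. x \<notin> I2 \<Longrightarrow> \<phi> x = 0"
  shows "(\<lambda>x. x + \<phi> x) \<in> inv_class"
proof -
  define F where "F x = x + \<phi> x" for x
  have upper: "norm (F x - F y) \<le> 11/10 * norm (x - y)" for x y
    using norm_triangle_ineq[of "x - y" "\<phi> x - \<phi> y"] lip[of x y] by (simp add: F_def algebra_simps)
  have lower: "9/10 * norm (x - y) \<le> norm (F x - F y)" for x y
    using norm_triangle_ineq[of "F x - F y" "\<phi> y - \<phi> x"] lip[of y x]
    by (simp add: F_def algebra_simps norm_minus_commute)
  have inj: "x = y" if "F x = F y" for x y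
    using lower[of x y] that by simp
  have surj: "\<exists>x. F x = y" for y
  proof -
    \<comment> \<open>Solving \<open>F x = y\<close> means finding a fixed point of the contraction
      that sends x to \<open>y - \<phi> x\<close>.\<close>
    have "\<exists>!x. y - \<phi> x = x"
      using lip by (intro banach_fix_type[of "1/10"]) (auto simp: dist_norm norm_minus_commute)
    then obtain x where "y - \<phi> x = x" by blast
    then have "F x = y" by (simp add: F_def algebra_simps)
    then show ?thesis ..
  qed
  have off: "F x = x" if "x \<notin> I2" for x
    using supp[OF that] by (simp add: F_def)
  \<comment> \<open>If \<open>F x\<close> were off the square, then \<open>F (F x) = F x\<close>,
    and injectivity would give \<open>F x = x\<close>, contradicting that \<open>x\<close> lies in
    the square.\<close>
  have maps: "F x \<in> I2" if "x \<in> I2" for x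
    using off inj that by metis
  \<comment> \<open>A preimage of a point of the square cannot lie off the square, because there
    \<open>F\<close> is the identity.\<close>
  have ex1: "\<exists>!x. x \<in> I2 \<and> F x = y" if "y \<in> I2" for y
    using surj off inj that by metis
  have bij: "bij_betw F I2 I2"
    unfolding bij_betw_def inj_on_def using inj maps ex1 by blast
  have "28/25 \<ge> (11/10 :: real)" by simp
  note L = order_trans[OF this lip_const_ge]
  have "F \<in> F_INV"
    unfolding F_INV_def
  proof (intro CollectI conjI)
    show "F \<in> I2 \<rightarrow> I2" "\<forall>y\<in>I2. \<exists>!x. x \<in> I2 \<and> F x = y"
      using maps ex1 by auto
    have "inverse 2 * norm (x - x') \<le> norm (F x - F x') \<and> norm (F x - F x') \<le> 2 * norm (x - x')" for x x'
      using upper[of x x'] lower[of x x'] norm_ge_zero[of "x - x'"]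
      unfolding inverse_eq_divide by (intro conjI) linarith+
    then show "\<exists>L\<ge>1. \<forall>x\<in>I2. \<forall>x'\<in>I2. inverse L * norm (x - x') \<le> norm (F x - F x') \<and>
        norm (F x - F x') \<le> L * norm (x - x')"
      by (intro exI[of _ 2]) auto
  qed
  moreover have "(28/25)-lipschitz_on I2 F"
  proof (rule lipschitz_onI)
    show "dist (F x) (F y) \<le> 28/25 * dist x y" for x y
      using upper[of x y] norm_ge_zero[of "x - y"] unfolding dist_norm by linarith
  qed simp
  moreover have "(28/25)-lipschitz_on I2 (the_inv_into I2 F)"
  proof (rule lipschitz_onI)
    fix x y assume "x \<in> I2" "y \<in> I2"
    then have "F (the_inv_into I2 F x) = x" "F (the_inv_into I2 F y) = y"
      using bij by (auto simp: bij_betw_def f_the_inv_into_f)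
    then have "9/10 * norm (the_inv_into I2 F x - the_inv_into I2 F y) \<le> norm (x - y)"
      using lower[of "the_inv_into I2 F x" "the_inv_into I2 F y"] by simp
    then show "dist (the_inv_into I2 F x) (the_inv_into I2 F y) \<le> 28/25 * dist x y"
      using norm_ge_zero[of "x - y"] unfolding dist_norm by linarith
  qed simp
  ultimately have "F \<in> inv_class"
    using bij lipschitz_on_le[OF _ lip_const_ge] by (auto simp: inv_class_def F_Lip_def)
  then show ?thesis
    by (simp add: F_def[abs_def])
qed

definition cone_bump :: "real^2 \<Rightarrow> real \<Rightarrow> real^2 \<Rightarrow> real^2" where
  "cone_bump k \<rho> x = (max 0 (\<rho> - norm (x - k)) / 10) *\<^sub>R axis 1 1"

lemma norm_cone_bump: "norm (cone_bump k \<rho> x) = max 0 (\<rho> - norm (x - k)) / 10"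
  by (simp add: cone_bump_def)

lemma cone_bump_in_inv_class:
  assumes "cball k \<rho> \<subseteq> I2"
  shows "(\<lambda>x. x + cone_bump k \<rho> x) \<in> inv_class"
proof (rule perturbed_identity_in_inv_class)
  show "norm (cone_bump k \<rho> x - cone_bump k \<rho> y) \<le> norm (x - y) / 10" for x y
  proof -
    have "cone_bump k \<rho> x - cone_bump k \<rho> y =
      ((max 0 (\<rho> - norm (x - k)) - max 0 (\<rho> - norm (y - k))) / 10) *\<^sub>R axis 1 1"
      by (simp add: cone_bump_def scaleR_left_diff_distrib diff_divide_distrib)
    then have "norm (cone_bump k \<rho> x - cone_bump k \<rho> y) =
      \<bar>max 0 (\<rho> - norm (x - k)) - max 0 (\<rho> - norm (y - k))\<bar> / 10"
      by simp
    also have "\<dots> \<le> norm (x - y) / 10"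
      using norm_triangle_ineq3[of "x - k" "y - k"] by (intro divide_right_mono) auto
    finally show ?thesis .
  qed
  show "cone_bump k \<rho> x = 0" if "x \<notin> I2" for x
  proof -
    have "\<rho> < norm (x - k)"
      using that assms by (auto simp: dist_norm norm_minus_commute subset_iff not_le[symmetric])
    then show ?thesis by (simp add: cone_bump_def)
  qed
qed

lemma id_in_inv_class: "(\<lambda>x. x) \<in> inv_class"
  using perturbed_identity_in_inv_class[of "\<lambda>_. 0"] by simp

lemma Linf_norm_leD:
  assumes "Linf_norm f \<le> ennreal r" "0 \<le> r" "x \<in> I2"
  shows "\<bar>f x $ j\<bar> \<le> r"
proof -
  have "ennreal \<bar>f x $ j\<bar> \<le> (SUP x\<in>I2. ennreal \<bar>f x $ j\<bar>)"
    using assms by (intro SUP_upper)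
  also have "\<dots> \<le> Linf_norm f"
    unfolding Linf_norm_def by (intro Max_ge) auto
  finally have "ennreal \<bar>f x $ j\<bar> \<le> ennreal r"
    using assms by (meson order_trans)
  then show ?thesis
    using assms by simp
qed

text \<open>A set of the completed sigma-algebra differs from its main part by a null set. The
  change of measure can then be carried out for genuinely measurable events.\<close>

lemma measurable_event_in_completion:
  assumes E: "3/4 \<le> measure (completion M) E" and "finite_measure M"
  obtains A where "A \<in> sets M" "A \<subseteq> E" "ennreal (3/4) \<le> emeasure M A"
proof
  interpret finite_measure M by fact
  \<comment> \<open>A set outside the sigma-algebra has \<open>measure\<close> zero by convention,
    so the positive lower bound already forces membership.\<close>
  have E_sets: "E \<in> sets (completion M)"
    using E measure_notin_sets[of E "completion M"] by force
  then show "main_part M E \<in> sets M"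
    by (rule main_part_sets)
  show "main_part M E \<subseteq> E"
    using main_part_null_part_Un[OF E_sets] by blast
  have "emeasure M (main_part M E) = ennreal (measure (completion M) E)"
    using E_sets emeasure_eq_measure[of "main_part M E"]
    by (simp add: measure_def)
  then show "ennreal (3/4) \<le> emeasure M (main_part M E)"
    using E by (simp add: ennreal_leI)
qed

text \<open>Two-point argument: an estimator that is uniformly accurate at scale below the height of a
  bump distinguishes the identity from the bumped identity, so the chi-square divergence of the two
  sample laws cannot be small. This bounds the mass of the support of the bump from below.\<close>

lemma ball_mass_lower_bound:
  fixes T :: estimator
  assumes PX: "prob_space (PX p)" and \<sigma>: "0 < \<sigma>"
    and rate: "\<And>f. f \<in> inv_class \<Longrightarrow>
       sample_prob p \<sigma> n f (\<lambda>D. Linf_norm (\<lambda>x. T D x - f x) \<le> ennreal r) \<ge> 3/4"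
    and \<rho>: "cball k \<rho> \<subseteq> I2" "0 < \<rho>" "\<rho> \<le> 1" and r: "0 \<le> r" "2 * r < \<rho> / 10"
  shows "ln (9/4) \<le> exp (1 / \<sigma>\<^sup>2) / \<sigma>\<^sup>2 * (n * measure (PX p) (cball k \<rho>) * \<rho>\<^sup>2)"
proof -
  interpret PX: prob_space "PX p" by fact
  define f where "f = (\<lambda>x::real^2. x)"
  define f' where "f' = (\<lambda>x. x + cone_bump k \<rho> x)"
  have f: "f \<in> inv_class" and f': "f' \<in> inv_class"
    using id_in_inv_class cone_bump_in_inv_class[OF \<rho>(1)] by (auto simp: f_def f'_def)
  note fm = inv_class_measurable[OF f] and fm' = inv_class_measurable[OF f']
  define lr where "lr = likelihood_ratio \<sigma> f f'"
  have lr_meas: "lr \<in> borel_measurable (obs_law p \<sigma> f)"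
    using likelihood_ratio_measurable[OF fm fm'] by (simp add: lr_def)
  have density1: "obs_law p \<sigma> f' = density (obs_law p \<sigma> f) lr"
    unfolding lr_def by (rule obs_law_eq_density[OF fm fm' \<sigma>])
  have P: "prob_space (obs_law p \<sigma> f)" and P': "prob_space (obs_law p \<sigma> f')"
    by (intro prob_space_obs_law fm fm' PX \<sigma>)+
  define \<Lambda> where "\<Lambda> D = (\<Prod>i\<in>{1..n}. lr (D i))" for D
  \<comment> \<open>Likelihood ratios of independent observations multiply.\<close>
  have law': "sample_law p \<sigma> n f' = density (sample_law p \<sigma> n f) \<Lambda>"
    unfolding sample_law_def density1 \<Lambda>_def[abs_def]
    using P' by (intro PiM_density P lr_meas) (auto simp: density1)
  have S: "prob_space (sample_law p \<sigma> n f)" and S': "prob_space (sample_law p \<sigma> n f')"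
    unfolding sample_law_def by (intro prob_space_PiM P P')+
  interpret S: prob_space "sample_law p \<sigma> n f" by fact
  interpret S': prob_space "sample_law p \<sigma> n f'" by fact
  have sets_eq: "sets (sample_law p \<sigma> n f') = sets (sample_law p \<sigma> n f)"
    by (simp add: law')
  note lr_meas[measurable]
  have \<Lambda>_meas: "\<Lambda> \<in> borel_measurable (sample_law p \<sigma> n f)"
    unfolding \<Lambda>_def[abs_def] sample_law_def by measurable
  obtain A where A: "A \<in> sets (sample_law p \<sigma> n f)"
      "A \<subseteq> {D \<in> space (sample_law p \<sigma> n f). Linf_norm (\<lambda>x. T D x - f x) \<le> ennreal r}"
      "ennreal (3/4) \<le> emeasure (sample_law p \<sigma> n f) A"
    by (rule measurable_event_in_completion[OF rate[OF f, unfolded sample_prob_def] S.finite_measure_axioms])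
  obtain B where B: "B \<in> sets (sample_law p \<sigma> n f')"
      "B \<subseteq> {D \<in> space (sample_law p \<sigma> n f'). Linf_norm (\<lambda>x. T D x - f' x) \<le> ennreal r}"
      "ennreal (3/4) \<le> emeasure (sample_law p \<sigma> n f') B"
    by (rule measurable_event_in_completion[OF rate[OF f', unfolded sample_prob_def] S'.finite_measure_axioms])
  have "k \<in> I2"
    using \<rho> by auto
  \<comment> \<open>On a common sample the estimator would be within \<open>r\<close> of both
    functions at the centre \<open>k\<close>, where they differ by
    \<open>\<rho> / 10 > 2 * r\<close>.\<close>
  have "A \<inter> B = {}"
  proof (rule ccontr)
    assume "A \<inter> B \<noteq> {}"
    then obtain D where "D \<in> A" "D \<in> B" by blast
    then have D: "Linf_norm (\<lambda>x. T D x - f x) \<le> ennreal r" "Linf_norm (\<lambda>x. T D x - f' x) \<le> ennreal r"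
      using A(2) B(2) by auto
    have "\<bar>T D k $ 1 - f k $ 1\<bar> \<le> r" "\<bar>T D k $ 1 - f' k $ 1\<bar> \<le> r"
      using Linf_norm_leD[OF D(1) r(1) \<open>k \<in> I2\<close>, of 1] Linf_norm_leD[OF D(2) r(1) \<open>k \<in> I2\<close>, of 1]
      by (simp_all only: vector_minus_component)
    moreover have "f' k $ 1 - f k $ 1 = \<rho> / 10"
      using \<rho> by (simp add: f_def f'_def cone_bump_def axis_def)
    ultimately show False
      using r by linarith
  qed
  have B_sets: "B \<in> sets (sample_law p \<sigma> n f)"
    using B(1) sets_eq by simp
  have "measure (sample_law p \<sigma> n f) A \<ge> 3/4"
    using A(3) by (simp add: S.emeasure_eq_measure)
  moreover have "measure (sample_law p \<sigma> n f) A + measure (sample_law p \<sigma> n f) B \<le> 1"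
    using S.finite_measure_Union[OF A(1) B_sets \<open>A \<inter> B = {}\<close>] S.prob_le_1[of "A \<union> B"] by simp
  ultimately have "emeasure (sample_law p \<sigma> n f) B \<le> ennreal (1/4)"
    by (simp add: S.emeasure_eq_measure ennreal_leI)
  \<comment> \<open>\<open>B\<close> acts as a test: it has mass at most 1/4 under the identity,
    being disjoint from \<open>A\<close>, and at least 3/4 under the bumped identity.\<close>
  then have "ennreal (9/4) \<le> (\<integral>\<^sup>+D. (\<Lambda> D)\<^sup>2 \<partial>sample_law p \<sigma> n f)"
    using B(3) by (intro two_point_second_moment[OF S \<Lambda>_meas B_sets]) (simp_all add: law')
  also have "\<dots> = (\<integral>\<^sup>+z. (lr z)\<^sup>2 \<partial>obs_law p \<sigma> f) ^ n"
  proof -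
    interpret product_prob_space "\<lambda>_. obs_law p \<sigma> f" "{1..n}"
      by (intro product_prob_spaceI P)
    have "(\<integral>\<^sup>+D. (\<Lambda> D)\<^sup>2 \<partial>sample_law p \<sigma> n f) = (\<integral>\<^sup>+D. (\<Prod>i\<in>{1..n}. (lr (D i))\<^sup>2) \<partial>sample_law p \<sigma> n f)"
      by (simp add: \<Lambda>_def prod_power_distrib)
    also have "\<dots> = (\<Prod>i\<in>{1..n}. \<integral>\<^sup>+z. (lr z)\<^sup>2 \<partial>obs_law p \<sigma> f)"
      unfolding sample_law_def by (intro product_nn_integral_prod) auto
    finally show ?thesis
      by simp
  qed
  also have "(\<integral>\<^sup>+z. (lr z)\<^sup>2 \<partial>obs_law p \<sigma> f) = (\<integral>\<^sup>+x. ennreal (exp ((norm (f x - f' x))\<^sup>2 / \<sigma>\<^sup>2)) \<partial>PX p)"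
    unfolding lr_def by (rule likelihood_ratio_second_moment[OF fm fm' \<sigma>])
  also have "\<dots> \<le> ennreal (exp (exp (1 / \<sigma>\<^sup>2) / \<sigma>\<^sup>2 * (measure (PX p) (cball k \<rho>) * \<rho>\<^sup>2)))"
  proof -
    define K where "K = exp (1 / \<sigma>\<^sup>2) / \<sigma>\<^sup>2"
    have K: "0 \<le> K" by (simp add: K_def)
    have cball_sets: "cball k \<rho> \<in> sets (PX p)"
      using \<rho> by (auto simp: sets_restrict_space)
    \<comment> \<open>With t the exponent, exp t - 1 \<le> t exp t, and \<rho> \<le> 1 bounds the
      factor exp t by exp (1/\<sigma>^2); this is the origin of \<open>K\<close>. Off the ball the
      two functions agree and the exponent vanishes. The crude height bound \<rho> in place of
      \<open>\<rho> / 10\<close> costs only a constant.\<close>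
    have pt: "exp ((norm (f x - f' x))\<^sup>2 / \<sigma>\<^sup>2) \<le> 1 + K * \<rho>\<^sup>2 * indicator (cball k \<rho>) x" for x
    proof (cases "x \<in> cball k \<rho>")
      case True
      define t where "t = (norm (f x - f' x))\<^sup>2 / \<sigma>\<^sup>2"
      have "norm (f x - f' x) \<le> \<rho>"
        unfolding f_def f'_def
        by (simp add: norm_cone_bump) (use \<rho>(2) norm_ge_zero[of "x - k"] in linarith)
      then have "(norm (f x - f' x))\<^sup>2 \<le> \<rho>\<^sup>2"
        by (intro power_mono) auto
      then have t: "0 \<le> t" "t \<le> \<rho>\<^sup>2 / \<sigma>\<^sup>2"
        by (auto simp: t_def divide_right_mono)
      have "\<rho>\<^sup>2 / \<sigma>\<^sup>2 \<le> 1 / \<sigma>\<^sup>2"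
        using \<rho> by (intro divide_right_mono) (auto simp: power_le_one)
      then have t1: "t \<le> 1 / \<sigma>\<^sup>2"
        using t by simp
      have "1 - t \<le> exp (- t)"
        using exp_ge_add_one_self[of "- t"] by simp
      then have "(1 - t) * exp t \<le> exp (- t) * exp t"
        by (intro mult_right_mono) auto
      then have "exp t \<le> 1 + t * exp t"
        by (simp add: algebra_simps flip: exp_add)
      also have "t * exp t \<le> \<rho>\<^sup>2 / \<sigma>\<^sup>2 * exp (1 / \<sigma>\<^sup>2)"
        using t t1 by (intro mult_mono) auto
      finally show ?thesis
        using True by (simp add: t_def K_def mult_ac)
    next
      case False
      then have "cone_bump k \<rho> x = 0"
        by (simp add: cone_bump_def dist_norm norm_minus_commute)
      then show ?thesis
        using False by (simp add: f_def f'_def)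
    qed
    have "(\<integral>\<^sup>+x. ennreal (exp ((norm (f x - f' x))\<^sup>2 / \<sigma>\<^sup>2)) \<partial>PX p)
      \<le> (\<integral>\<^sup>+x. 1 + ennreal (K * \<rho>\<^sup>2) * indicator (cball k \<rho>) x \<partial>PX p)"
    proof (intro nn_integral_mono)
      fix x
      show "ennreal (exp ((norm (f x - f' x))\<^sup>2 / \<sigma>\<^sup>2)) \<le> 1 + ennreal (K * \<rho>\<^sup>2) * indicator (cball k \<rho>) x"
        using ennreal_leI[OF pt[of x]] K by (cases "x \<in> cball k \<rho>") auto
    qed
    also have "\<dots> = 1 + ennreal (K * \<rho>\<^sup>2) * emeasure (PX p) (cball k \<rho>)"
      using cball_sets by (simp add: nn_integral_add nn_integral_cmult PX.emeasure_space_1[simplified])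
    also have "\<dots> = ennreal (1 + K * (measure (PX p) (cball k \<rho>) * \<rho>\<^sup>2))"
      using K by (simp add: PX.emeasure_eq_measure mult_ac flip: ennreal_mult)
    \<comment> \<open>Passing from 1 + u to exp u turns the n-th power into multiplication of the
      exponent by n.\<close>
    also have "\<dots> \<le> ennreal (exp (K * (measure (PX p) (cball k \<rho>) * \<rho>\<^sup>2)))"
      by (intro ennreal_leI exp_ge_add_one_self)
    finally show ?thesis
      by (simp add: K_def)
  qed
  also have "\<dots> ^ n = ennreal (exp (exp (1 / \<sigma>\<^sup>2) / \<sigma>\<^sup>2 * (n * measure (PX p) (cball k \<rho>) * \<rho>\<^sup>2)))"
    by (simp add: ennreal_power mult_ac flip: exp_of_nat_mult)
  finally have "9/4 \<le> exp (exp (1 / \<sigma>\<^sup>2) / \<sigma>\<^sup>2 * (n * measure (PX p) (cball k \<rho>) * \<rho>\<^sup>2))"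
    by (simp add: power_mono)
  then have "ln (9/4) \<le> ln (exp (exp (1 / \<sigma>\<^sup>2) / \<sigma>\<^sup>2 * (n * measure (PX p) (cball k \<rho>) * \<rho>\<^sup>2)))"
    by (subst ln_le_cancel_iff) auto
  then show ?thesis
    by simp
qed

subsection \<open>Local averages and the discretised loss\<close>

lemma (in pair_sigma_finite) has_bochner_integral_product_mult:
  fixes u v :: "_ \<Rightarrow> real"
  assumes u: "integrable M1 u" and v: "integrable M2 v"
  shows "has_bochner_integral (M1 \<Otimes>\<^sub>M M2) (\<lambda>z. u (fst z) * v (snd z)) (integral\<^sup>L M1 u * integral\<^sup>L M2 v)"
proof -
  have int: "integrable (M1 \<Otimes>\<^sub>M M2) (\<lambda>z. u (fst z) * v (snd z))"
  proof (rule Fubini_integrable)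
    show "(\<lambda>z. u (fst z) * v (snd z)) \<in> borel_measurable (M1 \<Otimes>\<^sub>M M2)"
      using u v by measurable
    show "integrable M1 (\<lambda>x. \<integral>y. norm (u (fst (x, y)) * v (snd (x, y))) \<partial>M2)"
      using u v by (simp add: abs_mult)
    show "AE x in M1. integrable M2 (\<lambda>y. u (fst (x, y)) * v (snd (x, y)))"
      using v by simp
  qed
  then show ?thesis
    using integral_fst'[OF int] u v by (simp add: has_bochner_integral_iff)
qed

lemma borel_measurable_vec_component [measurable (raw)]:
  fixes f :: "'a \<Rightarrow> real^'n"
  assumes "f \<in> borel_measurable M"
  shows "(\<lambda>x. f x $ j) \<in> borel_measurable M"
  by (rule measurable_compose[OF assms]) (intro borel_measurable_continuous_onI continuous_intros)

text \<open>One summand of an inverse-probability weighted average. When \<open>q\<close> is the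
  mass of \<open>A\<close>, its mean is the average of the regression component over
  \<open>A\<close> under the conditional design law.\<close>

definition cell_obs :: "(real^2) set \<Rightarrow> real \<Rightarrow> 2 \<Rightarrow> (real^2) \<times> (real^2) \<Rightarrow> real" where
  "cell_obs A q j = (\<lambda>(x, y). indicator A x * (y $ j) / q)"

lemma cell_obs_measurable [measurable]:
  assumes [measurable]: "A \<in> sets borel"
  shows "cell_obs A q j \<in> borel_measurable obs_algebra"
proof -
  have [measurable]: "indicator A \<in> restrict_space borel I2 \<rightarrow>\<^sub>M (borel :: real measure)"
    by (intro measurable_restrict_space1) simp
  show ?thesis
    unfolding cell_obs_def by measurable
qed

text \<open>The summand splits into a function of the design point plus another such function times
  the noise component. The mixed terms vanish, since the noise is centred and independent of the
  design. In the second moment the squared weight 1/q^2 meets the mass q of the cell, so a single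
  factor 1/q remains.\<close>

lemma
  fixes j :: 2
  assumes PX: "prob_space (PX p)" and \<sigma>: "0 < \<sigma>"
    and f[measurable]: "f \<in> restrict_space borel I2 \<rightarrow>\<^sub>M borel" and f_le: "\<And>x. x \<in> I2 \<Longrightarrow> \<bar>f x $ j\<bar> \<le> 1"
    and A: "A \<in> sets borel" "A \<subseteq> I2" and q: "q = measure (PX p) A" "0 < q"
  shows cell_obs_moment1: "has_bochner_integral (obs_law p \<sigma> f) (cell_obs A q j)
      (\<integral>x. indicator A x * (f x $ j) / q \<partial>PX p)"
    and cell_obs_moment2: "integrable (obs_law p \<sigma> f) (\<lambda>z. (cell_obs A q j z)\<^sup>2)"
      "(\<integral>z. (cell_obs A q j z)\<^sup>2 \<partial>obs_law p \<sigma> f) \<le> (1 + \<sigma>\<^sup>2) / q"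
proof -
  interpret PX: prob_space "PX p" by fact
  interpret noise: prob_space "noise \<sigma>" by (rule prob_space_noise[OF \<sigma>])
  interpret pair_prob_space "PX p" "noise \<sigma>" ..
  have A_PX: "A \<in> sets (PX p)"
    using A by (auto simp: sets_restrict_space)
  define b where "b x = indicator A x / q" for x :: "real^2"
  define a where "a x = indicator A x * (f x $ j) / q" for x
  have b_meas: "b \<in> borel_measurable (PX p)"
    unfolding b_def[abs_def] using A_PX by measurable
  have f_meas: "(\<lambda>x. f x $ j) \<in> borel_measurable (PX p)"
    by measurable
  have a_eq: "a x = b x * (f x $ j)" for x
    by (simp add: a_def b_def)
  have b_le: "0 \<le> b x" "b x \<le> 1 / q" for x
    using q(2) by (auto simp: b_def indicator_def)
  have a_le: "\<bar>a x\<bar> \<le> 1 / q" if "x \<in> I2" for x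
  proof -
    have "\<bar>a x\<bar> = b x * \<bar>f x $ j\<bar>"
      using b_le by (simp add: a_eq abs_mult)
    also have "\<dots> \<le> 1 / q * 1"
      using that b_le f_le q by (intro mult_mono) auto
    finally show ?thesis by simp
  qed
  have a_meas: "a \<in> borel_measurable (PX p)"
    unfolding a_eq[abs_def] using b_meas f_meas by measurable
  have sq_le: "\<bar>u * v\<bar> \<le> 1 / q * (1 / q)" if "\<bar>u\<bar> \<le> 1 / q" "\<bar>v\<bar> \<le> 1 / q" for u v :: real
    unfolding abs_mult using that q by (intro mult_mono) auto
  have a_int: "integrable (PX p) a"
    by (rule PX.integrable_const_bound[of _ "1 / q"]) (auto intro!: AE_I2 a_le a_meas)
  have b_int: "integrable (PX p) b"
    using b_le by (intro PX.integrable_const_bound[of _ "1 / q"] b_meas AE_I2) simp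
  have ab_le: "norm (a x * a x) \<le> 1 / q * (1 / q)" "norm (a x * b x) \<le> 1 / q * (1 / q)"
    "norm (b x * b x) \<le> 1 / q * (1 / q)" if "x \<in> space (PX p)" for x
  proof -
    have "\<bar>a x\<bar> \<le> 1 / q" "\<bar>b x\<bar> \<le> 1 / q"
      using that a_le b_le by auto
    then show "norm (a x * a x) \<le> 1 / q * (1 / q)" "norm (a x * b x) \<le> 1 / q * (1 / q)"
      "norm (b x * b x) \<le> 1 / q * (1 / q)"
      by (simp_all only: real_norm_def sq_le)
  qed
  have a2_int: "integrable (PX p) (\<lambda>x. a x * a x)"
    by (rule PX.integrable_const_bound[OF AE_I2[OF ab_le(1)]]) (use a_meas in auto)
  have ab_int: "integrable (PX p) (\<lambda>x. a x * b x)"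
    by (rule PX.integrable_const_bound[OF AE_I2[OF ab_le(2)]]) (use a_meas b_meas in auto)
  have b2_int: "integrable (PX p) (\<lambda>x. b x * b x)"
    by (rule PX.integrable_const_bound[OF AE_I2[OF ab_le(3)]]) (use b_meas in auto)
  note mom = noise_moments[OF \<sigma>, of j]
  have one: "integrable (noise \<sigma>) (\<lambda>_. 1 :: real)" "(\<integral>e. (1 :: real) \<partial>noise \<sigma>) = 1"
    by (simp_all add: noise.prob_space del: space_noise)
  have T: "(\<lambda>(x, e). (x, f x + e)) \<in> PX p \<Otimes>\<^sub>M noise \<sigma> \<rightarrow>\<^sub>M obs_algebra"
    by (rule obs_map_measurable) measurable
  have Z_meas: "cell_obs A q j \<in> borel_measurable obs_algebra"
    using A(1) by measurable
  have Z2_meas: "(\<lambda>z. (cell_obs A q j z)\<^sup>2) \<in> borel_measurable obs_algebra"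
    using Z_meas by measurable
  have Z: "cell_obs A q j (case z of (x, e) \<Rightarrow> (x, f x + e)) = a (fst z) * 1 + b (fst z) * (snd z $ j)" for z
    by (cases z) (simp add: cell_obs_def a_def b_def algebra_simps add_divide_distrib)
  have "has_bochner_integral (PX p \<Otimes>\<^sub>M noise \<sigma>) (\<lambda>z. a (fst z) * 1 + b (fst z) * (snd z $ j))
      (integral\<^sup>L (PX p) a * 1 + integral\<^sup>L (PX p) b * 0)"
    using has_bochner_integral_product_mult[OF a_int one(1)] has_bochner_integral_product_mult[OF b_int mom(1)]
    unfolding one mom by (rule has_bochner_integral_add)
  then have "has_bochner_integral (PX p \<Otimes>\<^sub>M noise \<sigma>) (\<lambda>z. cell_obs A q j (case z of (x, e) \<Rightarrow> (x, f x + e)))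
      (integral\<^sup>L (PX p) a)"
    unfolding Z by simp
  then show "has_bochner_integral (obs_law p \<sigma> f) (cell_obs A q j) (\<integral>x. indicator A x * (f x $ j) / q \<partial>PX p)"
    unfolding obs_law_def has_bochner_integral_iff a_def[abs_def, symmetric]
    using integrable_distr_eq[OF T Z_meas] integral_distr[OF T Z_meas] by simp
  have Z2: "(cell_obs A q j (case z of (x, e) \<Rightarrow> (x, f x + e)))\<^sup>2 =
    (a (fst z) * a (fst z)) * 1 + 2 * ((a (fst z) * b (fst z)) * (snd z $ j)) + (b (fst z) * b (fst z)) * (snd z $ j)\<^sup>2" for z
    unfolding Z by (simp add: power2_eq_square algebra_simps)
  have "has_bochner_integral (PX p \<Otimes>\<^sub>M noise \<sigma>) (\<lambda>z. (a (fst z) * a (fst z)) * 1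
      + 2 * ((a (fst z) * b (fst z)) * (snd z $ j)) + (b (fst z) * b (fst z)) * (snd z $ j)\<^sup>2)
      ((\<integral>x. a x * a x \<partial>PX p) * 1 + 2 * ((\<integral>x. a x * b x \<partial>PX p) * 0) + (\<integral>x. b x * b x \<partial>PX p) * \<sigma>\<^sup>2)"
    using has_bochner_integral_product_mult[OF a2_int one(1)] has_bochner_integral_product_mult[OF ab_int mom(1)]
      has_bochner_integral_product_mult[OF b2_int mom(3)]
    unfolding one mom by (intro has_bochner_integral_add has_bochner_integral_mult_right)
  then have Z2_int: "has_bochner_integral (PX p \<Otimes>\<^sub>M noise \<sigma>) (\<lambda>z. (cell_obs A q j (case z of (x, e) \<Rightarrow> (x, f x + e)))\<^sup>2)
      ((\<integral>x. a x * a x \<partial>PX p) + (\<integral>x. b x * b x \<partial>PX p) * \<sigma>\<^sup>2)"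
    unfolding Z2 by simp
  then show "integrable (obs_law p \<sigma> f) (\<lambda>z. (cell_obs A q j z)\<^sup>2)"
    unfolding obs_law_def has_bochner_integral_iff using integrable_distr_eq[OF T Z2_meas] by simp
  have b_eq: "(\<integral>x. b x * b x \<partial>PX p) = 1 / q"
  proof -
    have "(\<integral>x. b x * b x \<partial>PX p) = (\<integral>x. (1 / q\<^sup>2) * indicator A x \<partial>PX p)"
      by (intro Bochner_Integration.integral_cong) (auto simp: b_def indicator_def power2_eq_square)
    also have "\<dots> = 1 / q\<^sup>2 * q"
      using A_PX q by (simp add: Int_absorb2 A)
    finally show ?thesis
      using q by (simp add: power2_eq_square)
  qed
  have "(\<integral>x. a x * a x \<partial>PX p) \<le> (\<integral>x. b x * b x \<partial>PX p)"
  proof (intro integral_mono a2_int b2_int)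
    fix x assume "x \<in> space (PX p)"
    then have "(f x $ j)\<^sup>2 \<le> 1"
      using f_le by (simp add: abs_square_le_1)
    then have "(b x)\<^sup>2 * (f x $ j)\<^sup>2 \<le> (b x)\<^sup>2 * 1"
      by (intro mult_left_mono) auto
    then show "a x * a x \<le> b x * b x"
      by (simp add: a_eq power2_eq_square mult_ac)
  qed
  then have "(\<integral>x. a x * a x \<partial>PX p) + (\<integral>x. b x * b x \<partial>PX p) * \<sigma>\<^sup>2 \<le> (1 + \<sigma>\<^sup>2) / q"
    by (simp add: b_eq add_divide_distrib)
  then show "(\<integral>z. (cell_obs A q j z)\<^sup>2 \<partial>obs_law p \<sigma> f) \<le> (1 + \<sigma>\<^sup>2) / q"
    using Z2_int unfolding obs_law_def has_bochner_integral_iff using integral_distr[OF T Z2_meas] by simp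
qed

text \<open>Normalising by the exact mass of the cell instead of the number of hits keeps the estimate linear
  in the data and avoids the case of an empty cell.\<close>

definition cell_estimate ::
    "real \<Rightarrow> (real^2 \<Rightarrow> real) \<Rightarrow> nat \<Rightarrow> (nat \<Rightarrow> (real^2) \<times> (real^2)) \<Rightarrow> real^2 \<Rightarrow> 2 \<Rightarrow> real" where
  "cell_estimate \<rho> p n D k j =
     (\<Sum>i\<in>{1..n}. cell_obs (cball k \<rho>) (measure (PX p) (cball k \<rho>)) j (D i)) / n"

lemma abs_le_1_I2: "x \<in> I2 \<Longrightarrow> \<bar>x $ j\<bar> \<le> 1"
  by (auto simp: I2_def abs_le_iff dest!: spec[of _ j])

text \<open>The second moment of a summand gives the variance term. The bias is at most
  \<open>2 * \<rho>\<close>, because \<open>f\<close> has Lipschitz constant 2 and the cell has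
  radius \<rho>.\<close>

lemma cell_estimate_error:
  assumes PX: "prob_space (PX p)" and \<sigma>: "0 < \<sigma>" and f: "f \<in> inv_class"
    and \<rho>: "cball k \<rho> \<subseteq> I2" "0 < \<rho>" and q: "0 < measure (PX p) (cball k \<rho>)" and n: "0 < n"
  shows "(\<integral>\<^sup>+D. ennreal ((cell_estimate \<rho> p n D k j - f k $ j)\<^sup>2) \<partial>sample_law p \<sigma> n f)
    \<le> ennreal ((1 + \<sigma>\<^sup>2) / (n * measure (PX p) (cball k \<rho>)) + (2 * \<rho>)\<^sup>2)"
proof -
  interpret PX: prob_space "PX p" by fact
  define A where "A = cball k \<rho>"
  define q' where "q' = measure (PX p) A"
  have q': "0 < q'" using q by (simp add: q'_def A_def)
  have A: "A \<in> sets borel" "A \<subseteq> I2"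
    using \<rho> by (auto simp: A_def)
  have A_PX: "A \<in> sets (PX p)"
    using A by (auto simp: sets_restrict_space)
  have fm: "f \<in> restrict_space borel I2 \<rightarrow>\<^sub>M borel"
    by (rule inv_class_measurable[OF f])
  have f1: "\<bar>f x $ j\<bar> \<le> 1" if "x \<in> I2" for x j
    using inv_class_in_I2[OF f that] by (rule abs_le_1_I2)
  have k: "k \<in> I2" using \<rho> by auto
  have moment1: "has_bochner_integral (obs_law p \<sigma> f) (cell_obs A q' j) (\<integral>x. indicator A x * (f x $ j) / q' \<partial>PX p)"
    and moment2: "integrable (obs_law p \<sigma> f) (\<lambda>z. (cell_obs A q' j z)\<^sup>2)"
      "(\<integral>z. (cell_obs A q' j z)\<^sup>2 \<partial>obs_law p \<sigma> f) \<le> (1 + \<sigma>\<^sup>2) / q'"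
    using cell_obs_moment1[OF PX \<sigma> fm f1 A q'_def q'] cell_obs_moment2[OF PX \<sigma> fm f1 A q'_def q'] by auto
  have bias: "\<bar>integral\<^sup>L (obs_law p \<sigma> f) (cell_obs A q' j) - f k $ j\<bar> \<le> 2 * \<rho>"
  proof -
    have f_meas: "(\<lambda>x. f x $ j) \<in> borel_measurable (PX p)"
      using fm by measurable
    have f_int: "integrable (PX p) (\<lambda>x. f x $ j)"
      using f1 f_meas by (intro PX.integrable_const_bound[of _ 1] AE_I2) auto
    have int1: "integrable (PX p) (\<lambda>x. indicator A x * (f x $ j) / q')"
      using f_int A_PX by (auto intro!: integrable_mult_indicator[where 'b=real, simplified])
    have "integrable (PX p) (\<lambda>x. indicator A x :: real)"
      by (rule integrable_real_indicator[OF A_PX]) (simp add: less_top[symmetric])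
    then have int2: "integrable (PX p) (\<lambda>x. indicator A x * c / q')" for c :: real
      by simp
    \<comment> \<open>The weights have total integral one, so comparing \<open>f\<close> on the cell
      with the constants \<open>f k $ j + 2 * \<rho>\<close> and \<open>f k $ j - 2 * \<rho>\<close>
      bounds the bias from both sides.\<close>
    have c: "(\<integral>x. indicator A x * c / q' \<partial>PX p) = c" for c :: real
      using A_PX A q' by (simp add: Int_absorb2 q'_def)
    have dev: "\<bar>f x $ j - f k $ j\<bar> \<le> 2 * \<rho>" if "x \<in> A" for x
    proof -
      have "\<bar>f x $ j - f k $ j\<bar> \<le> norm (f x - f k)"
        using component_le_norm_cart[of "f x - f k" j] by simp
      also have "\<dots> \<le> 2 * norm (x - k)"
        using that A k by (intro inv_class_lipschitz[OF f]) auto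
      also have "\<dots> \<le> 2 * \<rho>"
        using that by (simp add: A_def dist_norm norm_minus_commute)
      finally show ?thesis .
    qed
    have "(\<integral>x. indicator A x * (f x $ j) / q' \<partial>PX p) \<le> (\<integral>x. indicator A x * (f k $ j + 2 * \<rho>) / q' \<partial>PX p)"
      using dev q' by (intro integral_mono int1 int2 divide_right_mono) (auto simp: indicator_def abs_le_iff algebra_simps)
    moreover have "(\<integral>x. indicator A x * (f k $ j - 2 * \<rho>) / q' \<partial>PX p) \<le> (\<integral>x. indicator A x * (f x $ j) / q' \<partial>PX p)"
      using dev q' by (intro integral_mono int1 int2 divide_right_mono) (auto simp: indicator_def abs_le_iff algebra_simps)
    ultimately show ?thesis
      using moment1 unfolding c has_bochner_integral_iff by auto
  qed
  have "(\<integral>\<^sup>+D. ennreal (((\<Sum>i\<in>{1..n}. cell_obs A q' j (D i)) / card {1..n} - f k $ j)\<^sup>2) \<partial>PiM {1..n} (\<lambda>_. obs_law p \<sigma> f))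
    \<le> ennreal ((1 + \<sigma>\<^sup>2) / q' / card {1..n} + (2 * \<rho>)\<^sup>2)"
    using n moment1 by (intro PiM_sample_mean_squared_error moment2 bias prob_space_obs_law[OF fm PX \<sigma>])
      (auto simp: has_bochner_integral_iff)
  then show ?thesis
    by (simp add: cell_estimate_def sample_law_def A_def q'_def mult_ac)
qed

section \<open>From errors at grid points to the integrated loss\<close>

lemma emeasure_cball_le_square:
  assumes "0 \<le> r"
  shows "emeasure lborel (cball (a :: real^2) r) \<le> ennreal ((2 * r)\<^sup>2)"
proof -
  have "cball a r \<subseteq> cbox (\<chi> j. a $ j - r) (\<chi> j. a $ j + r)"
  proof
    fix x assume "x \<in> cball a r"
    then have "\<bar>x $ j - a $ j\<bar> \<le> r" for j
      using component_le_norm_cart[of "x - a" j] by (simp add: dist_norm norm_minus_commute)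
    then show "x \<in> cbox (\<chi> j. a $ j - r) (\<chi> j. a $ j + r)"
      by (auto simp: mem_box_cart abs_le_iff algebra_simps)
  qed
  then have "emeasure lborel (cball a r) \<le> emeasure lborel (cbox (\<chi> j. a $ j - r) (\<chi> j. a $ j + r))"
    by (intro emeasure_mono) auto
  also have "\<dots> = (\<Prod>b\<in>Basis. ((\<chi> j. a $ j + r) - (\<chi> j. a $ j - r)) \<bullet> b)"
  proof (intro emeasure_lborel_cbox)
    fix b :: "real^2" assume "b \<in> Basis"
    then obtain i where "b = axis i 1"
      by (auto simp: Basis_vec_def)
    then show "(\<chi> j. a $ j - r) \<bullet> b \<le> (\<chi> j. a $ j + r) \<bullet> b"
      using assms by (simp add: inner_axis)
  qed
  also have "\<dots> = (2 * r)\<^sup>2"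
    by (simp add: prod_Basis_vec inner_axis)
  finally show ?thesis .
qed

lemma ennreal_sqrt_square [simp]: "(ennreal_sqrt z)\<^sup>2 = z"
proof (cases z)
  case (real r)
  then show ?thesis
    by (simp add: ennreal_sqrt_def ennreal_power)
next
  case top
  then show ?thesis
    by (simp add: ennreal_sqrt_def power2_eq_square ennreal_mult_top)
qed

text \<open>A pointwise majorant by weighted indicators of balls is integrated with the bound
  \<open>B * (2 * r)\<^sup>2\<close> for the mass of each ball; the two components account for the
  factor 8. The centres are arbitrary, so that they can be grid points for the forward error and
  images of grid points for the inverse error.\<close>

lemma L2_norm_on_square_le:
  assumes p_meas: "p \<in> borel_measurable (restrict_space borel I2)"
    and p_le: "\<And>x. x \<in> I2 \<Longrightarrow> p x \<le> B" and B: "0 \<le> B"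
    and r: "0 \<le> r" and G: "finite G" and w: "\<And>k. k \<in> G \<Longrightarrow> 0 \<le> w k"
    and h: "\<And>x. x \<in> I2 \<Longrightarrow> (norm (h x))\<^sup>2 \<le> (\<Sum>k\<in>G. indicator (cball (a k) r) x * w k)"
  shows "(L2_norm_on (PX p) h)\<^sup>2 \<le> ennreal (8 * B * r\<^sup>2 * (\<Sum>k\<in>G. w k))"
proof -
  have ind_meas: "indicator (cball (a k) r) \<in> restrict_space borel I2 \<rightarrow>\<^sub>M (borel :: ennreal measure)" for k
    by (intro measurable_restrict_space1 borel_measurable_indicator) simp
  have "(\<integral>\<^sup>+x. ennreal (\<bar>h x $ j\<bar>\<^sup>2) \<partial>PX p) \<le> ennreal (4 * B * r\<^sup>2 * (\<Sum>k\<in>G. w k))" for j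
  proof -
    have "(\<integral>\<^sup>+x. ennreal (\<bar>h x $ j\<bar>\<^sup>2) \<partial>PX p) \<le> (\<integral>\<^sup>+x. (\<Sum>k\<in>G. ennreal (w k) * indicator (cball (a k) r) x) \<partial>PX p)"
    proof (intro nn_integral_mono)
      fix x assume "x \<in> space (PX p)"
      then have x: "x \<in> I2" by simp
      have "\<bar>h x $ j\<bar>\<^sup>2 \<le> (norm (h x))\<^sup>2"
        by (intro power_mono component_le_norm_cart) simp
      also have "\<dots> \<le> (\<Sum>k\<in>G. indicator (cball (a k) r) x * w k)"
        by (rule h[OF x])
      finally have "ennreal (\<bar>h x $ j\<bar>\<^sup>2) \<le> ennreal (\<Sum>k\<in>G. indicator (cball (a k) r) x * w k)"
        by (rule ennreal_leI)
      also have "\<dots> = (\<Sum>k\<in>G. ennreal (indicator (cball (a k) r) x * w k))"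
        using w by (simp add: sum_ennreal)
      also have "\<dots> = (\<Sum>k\<in>G. ennreal (w k) * indicator (cball (a k) r) x)"
        by (intro sum.cong) (auto simp: indicator_def)
      finally show "ennreal (\<bar>h x $ j\<bar>\<^sup>2) \<le> (\<Sum>k\<in>G. ennreal (w k) * indicator (cball (a k) r) x)" .
    qed
    also have "\<dots> = (\<Sum>k\<in>G. ennreal (w k) * (\<integral>\<^sup>+x. indicator (cball (a k) r) x \<partial>PX p))"
      using ind_meas by (simp add: nn_integral_sum nn_integral_cmult del: nn_integral_indicator)
    also have "\<dots> \<le> (\<Sum>k\<in>G. ennreal (w k) * (ennreal B * ennreal ((2 * r)\<^sup>2)))"
    proof (intro sum_mono mult_left_mono)
      fix k
      have "(\<integral>\<^sup>+x. indicator (cball (a k) r) x \<partial>PX p) \<le> ennreal B * emeasure lborel (cball (a k) r)"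
        using p_le by (intro nn_integral_indicator_PX_le[OF p_meas]) auto
      also have "\<dots> \<le> ennreal B * ennreal ((2 * r)\<^sup>2)"
        by (intro mult_left_mono emeasure_cball_le_square r) simp
      finally show "(\<integral>\<^sup>+x. indicator (cball (a k) r) x \<partial>PX p) \<le> ennreal B * ennreal ((2 * r)\<^sup>2)" .
    qed simp
    also have "\<dots> = (\<Sum>k\<in>G. ennreal (w k * (B * (2 * r)\<^sup>2)))"
      using w B by (intro sum.cong) (simp_all add: ennreal_mult)
    also have "\<dots> = ennreal (\<Sum>k\<in>G. w k * (B * (2 * r)\<^sup>2))"
      using w B by (intro sum_ennreal) simp
    also have "(\<Sum>k\<in>G. w k * (B * (2 * r)\<^sup>2)) = 4 * B * r\<^sup>2 * (\<Sum>k\<in>G. w k)"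
      by (subst sum_distrib_right[symmetric]) (simp add: power_mult_distrib)
    finally show ?thesis .
  qed
  then have "(\<Sum>j\<in>(UNIV :: 2 set). \<integral>\<^sup>+x. ennreal (\<bar>h x $ j\<bar>\<^sup>2) \<partial>PX p) \<le>
      (\<Sum>j\<in>(UNIV :: 2 set). ennreal (4 * B * r\<^sup>2 * (\<Sum>k\<in>G. w k)))"
    by (intro sum_mono)
  also have "\<dots> = ennreal (4 * B * r\<^sup>2 * (\<Sum>k\<in>G. w k) + 4 * B * r\<^sup>2 * (\<Sum>k\<in>G. w k))"
    unfolding sum_2 using B w by (intro ennreal_plus[symmetric]) (simp_all add: sum_nonneg)
  also have "4 * B * r\<^sup>2 * (\<Sum>k\<in>G. w k) + 4 * B * r\<^sup>2 * (\<Sum>k\<in>G. w k) = 8 * B * r\<^sup>2 * (\<Sum>k\<in>G. w k)"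
    by simp
  finally show ?thesis
    by (simp add: L2_norm_on_def)
qed

lemma single_cell_le_sum:
  fixes w :: "'k \<Rightarrow> real"
  assumes "finite G" "k \<in> G" "x \<in> C k" "\<And>k. k \<in> G \<Longrightarrow> 0 \<le> w k" "v \<le> w k"
  shows "v \<le> (\<Sum>k\<in>G. indicator (C k) x * w k)"
proof -
  have "indicator (C k) x * w k \<le> (\<Sum>k\<in>G. indicator (C k) x * w k)"
    using assms by (intro member_le_sum) auto
  then show ?thesis
    using assms by simp
qed

text \<open>The second term is bounded without a change of variables: if \<open>x = g\<^sup>-\<^sup>1 y\<close> lies near the grid
  point \<open>k\<close>, then \<open>y\<close> lies near \<open>g k\<close>, and \<open>\<bar>g\<^sup>-\<^sup>1 y - f\<^sup>-\<^sup>1 y\<bar>\<close> is at most a multiple of \<open>\<bar>f x - g x\<bar>\<close>.\<close>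

lemma inverse_loss_le_grid_loss:
  assumes p_meas: "p \<in> borel_measurable (restrict_space borel I2)"
    and p_le: "\<And>x. x \<in> I2 \<Longrightarrow> p x \<le> B" and B: "0 \<le> B"
    and f: "f \<in> inv_class" and g: "g \<in> inv_class"
    and G: "finite G" "G \<subseteq> I2" "\<And>x. x \<in> I2 \<Longrightarrow> \<exists>k\<in>G. norm (x - k) \<le> 2 * \<rho>" and \<rho>: "0 \<le> \<rho>"
  shows "(L2_norm_on (PX p) (\<lambda>x. g x - f x))\<^sup>2
      + (L2_norm_on (PX p) (\<lambda>y. quasi_inverse c g y - the_inv_into I2 f y))\<^sup>2
    \<le> ennreal (1088 * B * \<rho>\<^sup>2 * (\<Sum>k\<in>G. (norm (g k - f k))\<^sup>2 + 64 * \<rho>\<^sup>2))"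
proof -
  define w where "w k = (norm (g k - f k))\<^sup>2 + 64 * \<rho>\<^sup>2" for k
  have w: "0 \<le> w k" for k
    by (simp add: w_def)
  \<comment> \<open>Both functions move by at most \<open>2 * (2 * \<rho>)\<close> between
    \<open>x\<close> and \<open>k\<close>, which adds up to \<open>8 * \<rho>\<close> and explains
    the term \<open>64 * \<rho>\<^sup>2\<close> in \<open>w\<close>.\<close>
  have near: "(norm (g x - f x))\<^sup>2 \<le> 2 * w k" if "x \<in> I2" "k \<in> G" "norm (x - k) \<le> 2 * \<rho>" for x k
  proof -
    have k: "k \<in> I2" using that G by auto
    have "g x - f x = (g k - f k) + (g x - g k) + (f k - f x)"
      by simp
    then have "norm (g x - f x) \<le> norm (g k - f k) + norm (g x - g k) + norm (f k - f x)"
      using norm_triangle_ineq[of "g k - f k + (g x - g k)" "f k - f x"] norm_triangle_ineq[of "g k - f k" "g x - g k"]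
      by simp
    also have "\<dots> \<le> norm (g k - f k) + 8 * \<rho>"
      using inv_class_lipschitz[OF g that(1) k] inv_class_lipschitz[OF f k that(1)] that(3)
      by (simp add: norm_minus_commute[of k x])
    finally have "(norm (g x - f x))\<^sup>2 \<le> (norm (g k - f k) + 8 * \<rho>)\<^sup>2"
      by (intro power_mono) auto
    also have "\<dots> \<le> 2 * w k"
      using zero_le_power2[of "norm (g k - f k) - 8 * \<rho>"]
      by (simp add: w_def power2_eq_square algebra_simps)
    finally show ?thesis .
  qed
  have "(L2_norm_on (PX p) (\<lambda>x. g x - f x))\<^sup>2 \<le> ennreal (8 * B * (2 * \<rho>)\<^sup>2 * (\<Sum>k\<in>G. 2 * w k))"
  proof (rule L2_norm_on_square_le[OF p_meas p_le B])
    fix x assume x: "x \<in> I2"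
    then obtain k where k: "k \<in> G" "norm (x - k) \<le> 2 * \<rho>"
      using G(3) by blast
    show "(norm (g x - f x))\<^sup>2 \<le> (\<Sum>k\<in>G. indicator (cball k (2 * \<rho>)) x * (2 * w k))"
      using near[OF x k] k w
      by (intro single_cell_le_sum[OF G(1), of k]) (auto simp: dist_norm norm_minus_commute)
  qed (use \<rho> G w in auto)
  moreover have "(L2_norm_on (PX p) (\<lambda>y. quasi_inverse c g y - the_inv_into I2 f y))\<^sup>2
      \<le> ennreal (8 * B * (4 * \<rho>)\<^sup>2 * (\<Sum>k\<in>G. 8 * w k))"
  proof (rule L2_norm_on_square_le[OF p_meas p_le B])
    fix y assume y: "y \<in> I2"
    define x where "x = the_inv_into I2 g y"
    have x: "x \<in> I2" "g x = y"
      using inv_class_the_inv[OF g y] by (auto simp: x_def)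
    obtain k where k: "k \<in> G" "norm (x - k) \<le> 2 * \<rho>"
      using G(3)[OF x(1)] by blast
    have kI: "k \<in> I2" using k G by auto
    \<comment> \<open>Since y = g x and x is the inverse of \<open>f\<close> at \<open>f x\<close>,
      the difference of the two inverses at y is a difference of one inverse at two points, to which
      its Lipschitz bound applies.\<close>
    have "norm (the_inv_into I2 f (f x) - the_inv_into I2 f y) \<le> 2 * norm (f x - g x)"
      using inv_class_inverse_lipschitz[OF f inv_class_in_I2[OF f x(1)] y] x by simp
    then have "norm (quasi_inverse c g y - the_inv_into I2 f y) \<le> 2 * norm (g x - f x)"
      using quasi_inverse_inv_class[OF g y] inv_class_the_inv_apply[OF f x(1)]
      by (simp add: x_def norm_minus_commute)
    then have "(norm (quasi_inverse c g y - the_inv_into I2 f y))\<^sup>2 \<le> (2 * norm (g x - f x))\<^sup>2"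
      by (intro power_mono) auto
    also have "\<dots> \<le> 8 * w k"
      using near[OF x(1) k] by (simp add: power_mult_distrib)
    finally have le: "(norm (quasi_inverse c g y - the_inv_into I2 f y))\<^sup>2 \<le> 8 * w k" .
    have "norm (g x - g k) \<le> 4 * \<rho>"
      using inv_class_lipschitz[OF g x(1) kI] k by simp
    then show "(norm (quasi_inverse c g y - the_inv_into I2 f y))\<^sup>2
        \<le> (\<Sum>k\<in>G. indicator (cball (g k) (4 * \<rho>)) y * (8 * w k))"
      using le k w x by (intro single_cell_le_sum[OF G(1), of k]) (auto simp: dist_norm norm_minus_commute)
  qed (use \<rho> G w in auto)
  ultimately have "(L2_norm_on (PX p) (\<lambda>x. g x - f x))\<^sup>2
      + (L2_norm_on (PX p) (\<lambda>y. quasi_inverse c g y - the_inv_into I2 f y))\<^sup>2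
      \<le> ennreal (8 * B * (2 * \<rho>)\<^sup>2 * (\<Sum>k\<in>G. 2 * w k)) + ennreal (8 * B * (4 * \<rho>)\<^sup>2 * (\<Sum>k\<in>G. 8 * w k))"
    by (rule add_mono)
  also have "\<dots> = ennreal (8 * B * (2 * \<rho>)\<^sup>2 * (\<Sum>k\<in>G. 2 * w k) + 8 * B * (4 * \<rho>)\<^sup>2 * (\<Sum>k\<in>G. 8 * w k))"
    using B w by (intro ennreal_plus[symmetric]) (auto intro!: mult_nonneg_nonneg sum_nonneg)
  \<comment> \<open>The constant is 64 from the forward error plus 1024 from the inverse
    error.\<close>
  also have "8 * B * (2 * \<rho>)\<^sup>2 * (\<Sum>k\<in>G. 2 * w k) + 8 * B * (4 * \<rho>)\<^sup>2 * (\<Sum>k\<in>G. 8 * w k)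
    = 1088 * B * \<rho>\<^sup>2 * (\<Sum>k\<in>G. w k)"
    by (simp add: power_mult_distrib flip: sum_distrib_left)
  finally show ?thesis
    by (simp add: w_def)
qed

text \<open>Rounding the finitely many grid values to multiples of \<rho> leaves finitely many
  codes, since all values lie in the square. Two functions with the same code differ by at most
  \<rho> in each of the two components. Closeness on the grid suffices, and the net is taken inside
  the class so that its members are invertible.\<close>

lemma inv_class_finite_grid_net:
  assumes G: "finite G" "G \<subseteq> I2" and \<rho>: "0 < \<rho>"
  obtains S where "finite S" "S \<subseteq> inv_class" "S \<noteq> {}"
    "\<And>f. f \<in> inv_class \<Longrightarrow> \<exists>s\<in>S. \<forall>k\<in>G. (norm (s k - f k))\<^sup>2 \<le> 2 * \<rho>\<^sup>2"
proof -
  define code where "code f = (\<lambda>kj\<in>G \<times> (UNIV :: 2 set). \<lfloor>f (fst kj) $ snd kj / \<rho>\<rfloor>)" for f :: "real^2 \<Rightarrow> real^2"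
  define R where "R = {\<lfloor>- 1 / \<rho>\<rfloor>..\<lfloor>1 / \<rho>\<rfloor>}"
  have "code ` inv_class \<subseteq> (\<Pi>\<^sub>E kj\<in>G \<times> UNIV. R)"
  proof
    fix c assume "c \<in> code ` inv_class"
    then obtain f where f: "f \<in> inv_class" "c = code f" by auto
    have "\<lfloor>f k $ j / \<rho>\<rfloor> \<in> R" if "k \<in> G" for k j
    proof -
      have "\<bar>f k $ j\<bar> \<le> 1"
        using that G inv_class_in_I2[OF f(1)] by (auto intro: abs_le_1_I2)
      then have "- 1 / \<rho> \<le> f k $ j / \<rho>" "f k $ j / \<rho> \<le> 1 / \<rho>"
        using \<rho> by (auto intro!: divide_right_mono simp: abs_le_iff simp del: divide_minus_left)
      then show ?thesis
        unfolding R_def by (auto intro: floor_mono)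
    qed
    then show "c \<in> (\<Pi>\<^sub>E kj\<in>G \<times> UNIV. R)"
      by (auto simp: f(2) code_def)
  qed
  then have "finite (code ` inv_class)"
    by (rule finite_subset) (use G in \<open>auto intro!: finite_PiE simp: R_def\<close>)
  \<comment> \<open>One representative is kept for each code that actually occurs.\<close>
  then obtain S where S: "S \<subseteq> inv_class" "finite S" "code ` inv_class = code ` S"
    using finite_subset_image[of "code ` inv_class" code inv_class] by blast
  have "\<exists>s\<in>S. \<forall>k\<in>G. (norm (s k - f k))\<^sup>2 \<le> 2 * \<rho>\<^sup>2" if f: "f \<in> inv_class" for f
  proof -
    obtain s where s: "s \<in> S" "code f = code s"
      using f S(3) by (metis imageE imageI)
    have "(norm (s k - f k))\<^sup>2 \<le> 2 * \<rho>\<^sup>2" if "k \<in> G" for k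
    proof -
      have "(s k $ j - f k $ j)\<^sup>2 \<le> \<rho>\<^sup>2" for j
      proof -
        have "\<lfloor>f k $ j / \<rho>\<rfloor> = \<lfloor>s k $ j / \<rho>\<rfloor>"
          using fun_cong[OF s(2), of "(k, j)"] \<open>k \<in> G\<close> by (simp add: code_def)
        then have "\<bar>s k $ j / \<rho> - f k $ j / \<rho>\<bar> \<le> 1"
          by linarith
        then have "\<bar>s k $ j - f k $ j\<bar> \<le> \<rho>"
          using \<rho> by (simp add: divide_le_eq flip: diff_divide_distrib)
        then show ?thesis
          using power_mono[of "\<bar>s k $ j - f k $ j\<bar>" \<rho> 2] by simp
      qed
      from this[of 1] this[of 2] show ?thesis
        unfolding norm_vec2_power2 sum_2 vector_minus_component by linarith
    qed
    then show ?thesis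
      using s(1) by blast
  qed
  then show ?thesis
    using that S id_in_inv_class by blast
qed

text \<open>The points are the centres of an m by m subdivision into squares of side
  \<open>2 * \<rho>\<close>. The inscribed balls stay in the square, as the bumps require; they miss
  the corners of the cells, so the covering radius is \<open>2 * \<rho>\<close> instead.\<close>

lemma I2_grid:
  assumes m: "0 < m" and \<rho>_def: "\<rho> = 1 / real m"
  obtains G where "finite G" "card G \<le> m * m" "\<And>k. k \<in> G \<Longrightarrow> cball k \<rho> \<subseteq> I2"
    "\<And>x. x \<in> I2 \<Longrightarrow> \<exists>k\<in>G. norm (x - k) \<le> 2 * \<rho>"
proof
  define t where "t a = (2 * real a + 1) * \<rho> - 1" for a :: nat
  define P :: "nat \<times> nat \<Rightarrow> real^2" where "P ab = vector [t (fst ab), t (snd ab)]" for ab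
  define G where "G = P ` ({..<m} \<times> {..<m})"
  have \<rho>: "0 < \<rho>" "real m * \<rho> = 1"
    using m by (auto simp: \<rho>_def)
  show "finite G"
    by (simp add: G_def)
  show "card G \<le> m * m"
    using card_image_le[of "{..<m} \<times> {..<m}" P] by (simp add: G_def)
  have t_bounds: "\<rho> - 1 \<le> t a" "t a \<le> 1 - \<rho>" if "a < m" for a
  proof -
    show "\<rho> - 1 \<le> t a"
      using \<rho> by (simp add: t_def algebra_simps)
    have "(2 * real a + 1) * \<rho> \<le> (2 * real m - 1) * \<rho>"
      using that \<rho> by (intro mult_right_mono) auto
    then show "t a \<le> 1 - \<rho>"
      using \<rho> by (simp add: t_def algebra_simps)
  qed
  have cover: "\<exists>a<m. \<bar>u - t a\<bar> \<le> \<rho>" if "-1 \<le> u" "u \<le> 1" for u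
  \<comment> \<open>At the right endpoint the floor below would give the index m, one beyond the
    last cell.\<close>
  proof (cases "u = 1")
    case True
    have "u - t (m - 1) = \<rho>"
      using True m \<rho> by (simp add: t_def of_nat_diff algebra_simps)
    then show ?thesis
      using m \<rho> by (intro exI[of _ "m - 1"]) auto
  next
    case False
    define a where "a = nat \<lfloor>(u + 1) * real m / 2\<rfloor>"
    have "0 \<le> (u + 1) * real m / 2" "(u + 1) * real m / 2 < real m"
      using that False m by auto
    then have "real a \<le> (u + 1) * real m / 2" "(u + 1) * real m / 2 < real a + 1" "a < m"
      unfolding a_def by linarith+
    then have "2 * real a * \<rho> \<le> u + 1" "u + 1 \<le> 2 * (real a + 1) * \<rho>"
      using m by (simp_all add: \<rho>_def field_simps)
    then have "\<bar>u - t a\<bar> \<le> \<rho>"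
      by (simp add: t_def algebra_simps abs_le_iff)
    then show ?thesis
      using \<open>a < m\<close> by blast
  qed
  show "cball k \<rho> \<subseteq> I2" if "k \<in> G" for k
  proof
    fix x assume x: "x \<in> cball k \<rho>"
    have "\<rho> - 1 \<le> k $ j \<and> k $ j \<le> 1 - \<rho>" for j
      using that t_bounds exhaust_2[of j] by (auto simp: G_def P_def)
    moreover have "\<bar>k $ j - x $ j\<bar> \<le> \<rho>" for j
      using component_le_norm_cart[of "k - x" j] x by (simp add: dist_norm)
    ultimately have "- 1 \<le> x $ j \<and> x $ j \<le> 1" for j
      by (smt (verit))
    then show "x \<in> I2"
      by (simp add: I2_def)
  qed
  show "\<exists>k\<in>G. norm (x - k) \<le> 2 * \<rho>" if "x \<in> I2" for x
  proof -
    have "- 1 \<le> x $ j" "x $ j \<le> 1" for j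
      using that by (auto simp: I2_def)
    then obtain a b where ab: "a < m" "\<bar>x $ 1 - t a\<bar> \<le> \<rho>" "b < m" "\<bar>x $ 2 - t b\<bar> \<le> \<rho>"
      using cover by metis
    have "norm (x - P (a, b)) \<le> (\<Sum>j\<in>UNIV. \<bar>(x - P (a, b)) $ j\<bar>)"
      by (rule norm_le_l1_cart)
    also have "\<dots> \<le> 2 * \<rho>"
      using ab by (simp add: sum_2 P_def)
    finally show ?thesis
      using ab by (auto simp: G_def)
  qed
qed

subsection \<open>The projected estimator\<close>

lemma square_diff_le: "((u :: real) - v)\<^sup>2 \<le> 2 * (w - u)\<^sup>2 + 2 * (w - v)\<^sup>2"
proof -
  have "2 * (w - u)\<^sup>2 + 2 * (w - v)\<^sup>2 - (u - v)\<^sup>2 = (2 * w - u - v)\<^sup>2"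
    by (simp add: power2_eq_square algebra_simps)
  then show ?thesis
    using zero_le_power2[of "2 * w - u - v"] by linarith
qed

text \<open>The estimator is the member of a finite net closest to the vector of local averages. The
  net and the selection rule do not depend on \<open>f\<close>, so one estimator serves the whole
  class. In the constant, M + 4 is variance plus squared bias in units of
  \<open>\<rho>\<^sup>2\<close>.\<close>

lemma grid_estimator_risk:
  fixes \<rho> :: real
  assumes p_meas: "p \<in> borel_measurable (restrict_space borel I2)"
    and p_le: "\<And>x. x \<in> I2 \<Longrightarrow> p x \<le> B" and B: "0 \<le> B"
    and PX: "prob_space (PX p)" and \<sigma>: "0 < \<sigma>" and n: "0 < n" and \<rho>: "0 < \<rho>"
    and G: "finite G" "\<And>k. k \<in> G \<Longrightarrow> cball k \<rho> \<subseteq> I2" "\<And>x. x \<in> I2 \<Longrightarrow> \<exists>k\<in>G. norm (x - k) \<le> 2 * \<rho>"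
    and card_G: "real (card G) * \<rho>\<^sup>2 \<le> 1"
    and mass: "\<And>k. k \<in> G \<Longrightarrow> 0 < measure (PX p) (cball k \<rho>)"
      "\<And>k. k \<in> G \<Longrightarrow> (1 + \<sigma>\<^sup>2) / (n * measure (PX p) (cball k \<rho>)) \<le> M * \<rho>\<^sup>2" and M: "0 \<le> M"
  obtains g where "g \<in> estimators n"
    "\<And>f. f \<in> inv_class \<Longrightarrow> inverse_risk (\<lambda>z. z\<^sup>2) p \<sigma> c n g f \<le> ennreal (1088 * B * (72 + 12 * (M + 4)) * \<rho>\<^sup>2)"
proof -
  have G_I2: "G \<subseteq> I2"
    using G(2) \<rho> by force
  obtain S where S: "finite S" "S \<subseteq> inv_class" "S \<noteq> {}"
    and net: "\<And>f. f \<in> inv_class \<Longrightarrow> \<exists>s\<in>S. \<forall>k\<in>G. (norm (s k - f k))\<^sup>2 \<le> 2 * \<rho>\<^sup>2"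
    using inv_class_finite_grid_net[OF G(1) G_I2 \<rho>] by blast
  define est where "est D k j = cell_estimate \<rho> p n D k j" for D k j
  define dist2 where "dist2 D s = (\<Sum>k\<in>G. \<Sum>j\<in>UNIV. (est D k j - s k $ j)\<^sup>2)"
    for D and s :: "real^2 \<Rightarrow> real^2"
  define \<Omega> where "\<Omega> = PiM {1..n} (\<lambda>_. obs_algebra)"
  have est_meas: "(\<lambda>D. est D k j) \<in> borel_measurable \<Omega>" for k j
    unfolding est_def cell_estimate_def \<Omega>_def by measurable
  note est_meas[measurable]
  have dist2_meas: "(\<lambda>D. dist2 D s) \<in> borel_measurable \<Omega>" for s
    unfolding dist2_def by measurable
  obtain e :: "nat \<Rightarrow> real^2 \<Rightarrow> real^2" and N where N: "N \<in> \<Omega> \<rightarrow>\<^sub>M count_space UNIV" and e: "range e \<subseteq> S"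
    and argmin: "\<And>D s. s \<in> S \<Longrightarrow> dist2 D (e (N D)) \<le> dist2 D s"
    by (rule measurable_finite_argmin[OF S(1,3), of dist2 \<Omega>]) (use dist2_meas in auto)
  have e_class: "e i \<in> inv_class" for i
    using e S(2) by blast
  define g where "g D = e (N D)" for D
  \<comment> \<open>Joint measurability holds because only countably many functions can be selected,
    each of them measurable in the space variable.\<close>
  have "(\<lambda>z. e (N (fst z)) (snd z)) \<in> \<Omega> \<Otimes>\<^sub>M restrict_space borel I2 \<rightarrow>\<^sub>M borel"
  proof (rule measurable_compose_countable)
    show "(\<lambda>z. e i (snd z)) \<in> \<Omega> \<Otimes>\<^sub>M restrict_space borel I2 \<rightarrow>\<^sub>M borel" for i
      by (rule measurable_compose[OF measurable_snd inv_class_measurable[OF e_class]])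
    show "(\<lambda>z. N (fst z)) \<in> \<Omega> \<Otimes>\<^sub>M restrict_space borel I2 \<rightarrow>\<^sub>M count_space UNIV"
      by (rule measurable_compose[OF measurable_fst N])
  qed
  then have "g \<in> estimators n"
    by (simp add: estimators_def g_def \<Omega>_def case_prod_beta')
  moreover have "inverse_risk (\<lambda>z. z\<^sup>2) p \<sigma> c n g f \<le> ennreal (1088 * B * (72 + 12 * (M + 4)) * \<rho>\<^sup>2)"
    if f: "f \<in> inv_class" for f
  proof -
    define K where "K = 1088 * B * \<rho>\<^sup>2"
    have K: "0 \<le> K"
      using B by (simp add: K_def)
    obtain s where s: "s \<in> S" "\<And>k. k \<in> G \<Longrightarrow> (norm (s k - f k))\<^sup>2 \<le> 2 * \<rho>\<^sup>2"
      using net[OF f] by blast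
    \<comment> \<open>The selected function is compared with the truth through the averages, and its
      distance to them is at most that of the net member \<open>s\<close> near the truth. Two uses
      of the quadratic triangle inequality produce 6 and 8; the latter joins the discretisation term
      64 to give 72.\<close>
    have sum_le: "(\<Sum>k\<in>G. (norm (g D k - f k))\<^sup>2 + 64 * \<rho>\<^sup>2) \<le> 72 + 6 * dist2 D f" for D
    proof -
      have "(\<Sum>k\<in>G. (norm (g D k - f k))\<^sup>2) \<le>
          (\<Sum>k\<in>G. \<Sum>j\<in>UNIV. 2 * (est D k j - g D k $ j)\<^sup>2 + 2 * (est D k j - f k $ j)\<^sup>2)"
        unfolding norm_vec2_power2 vector_minus_component by (intro sum_mono square_diff_le)
      also have "\<dots> = 2 * dist2 D (g D) + 2 * dist2 D f"
        by (simp add: dist2_def sum.distrib sum_distrib_left)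
      finally have 1: "(\<Sum>k\<in>G. (norm (g D k - f k))\<^sup>2) \<le> 2 * dist2 D (g D) + 2 * dist2 D f" .
      have "dist2 D s \<le> (\<Sum>k\<in>G. \<Sum>j\<in>UNIV. 2 * (f k $ j - est D k j)\<^sup>2 + 2 * (f k $ j - s k $ j)\<^sup>2)"
        unfolding dist2_def by (intro sum_mono square_diff_le)
      also have "\<dots> = 2 * dist2 D f + 2 * (\<Sum>k\<in>G. (norm (s k - f k))\<^sup>2)"
        by (simp add: dist2_def sum.distrib sum_distrib_left norm_vec2_power2 power2_commute[of "f _ $ _"])
      also have "(\<Sum>k\<in>G. (norm (s k - f k))\<^sup>2) \<le> (\<Sum>k\<in>G. 2 * \<rho>\<^sup>2)"
        by (intro sum_mono s)
      finally have 2: "dist2 D s \<le> 2 * dist2 D f + 4 * (real (card G) * \<rho>\<^sup>2)"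
        by simp
      have "dist2 D (g D) \<le> dist2 D s"
        unfolding g_def by (rule argmin[OF s(1)])
      with 1 2 have "(\<Sum>k\<in>G. (norm (g D k - f k))\<^sup>2) \<le> 6 * dist2 D f + 8 * (real (card G) * \<rho>\<^sup>2)"
        by linarith
      moreover have "(\<Sum>k\<in>G. (norm (g D k - f k))\<^sup>2 + 64 * \<rho>\<^sup>2)
          = (\<Sum>k\<in>G. (norm (g D k - f k))\<^sup>2) + 64 * (real (card G) * \<rho>\<^sup>2)"
        by (simp add: sum.distrib)
      ultimately show ?thesis
        using card_G by linarith
    qed
    have sets: "sets (sample_law p \<sigma> n f) = sets \<Omega>"
      unfolding sample_law_def \<Omega>_def by (intro sets_PiM_cong) simp_all
    have law: "prob_space (sample_law p \<sigma> n f)"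
      unfolding sample_law_def by (intro prob_space_PiM prob_space_obs_law inv_class_measurable f PX \<sigma>)
    have sq_meas: "(\<lambda>D. ennreal ((est D k j - f k $ j)\<^sup>2)) \<in> borel_measurable (sample_law p \<sigma> n f)" for k j
      unfolding measurable_cong_sets[OF sets refl] by measurable
    have d_meas: "(\<lambda>D. ennreal (dist2 D f)) \<in> borel_measurable (sample_law p \<sigma> n f)"
      unfolding measurable_cong_sets[OF sets refl] using dist2_meas by measurable
    have "(\<integral>\<^sup>+D. ennreal (dist2 D f) \<partial>sample_law p \<sigma> n f)
        = (\<integral>\<^sup>+D. (\<Sum>k\<in>G. \<Sum>j\<in>UNIV. ennreal ((est D k j - f k $ j)\<^sup>2)) \<partial>sample_law p \<sigma> n f)"
      by (simp add: dist2_def sum_nonneg flip: sum_ennreal)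
    also have "\<dots> = (\<Sum>k\<in>G. \<Sum>j\<in>UNIV. \<integral>\<^sup>+D. ennreal ((est D k j - f k $ j)\<^sup>2) \<partial>sample_law p \<sigma> n f)"
      using sq_meas by (simp add: nn_integral_sum del: sum_ennreal)
    also have "\<dots> \<le> (\<Sum>k\<in>G. \<Sum>j\<in>(UNIV :: 2 set). ennreal ((M + 4) * \<rho>\<^sup>2))"
    proof (intro sum_mono)
      fix k and j :: 2 assume k: "k \<in> G"
      have "(\<integral>\<^sup>+D. ennreal ((est D k j - f k $ j)\<^sup>2) \<partial>sample_law p \<sigma> n f)
        \<le> ennreal ((1 + \<sigma>\<^sup>2) / (n * measure (PX p) (cball k \<rho>)) + (2 * \<rho>)\<^sup>2)"
        unfolding est_def by (rule cell_estimate_error[OF PX \<sigma> f G(2)[OF k] \<rho> mass(1)[OF k] n])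
      also have "\<dots> \<le> ennreal ((M + 4) * \<rho>\<^sup>2)"
        using mass(2)[OF k] by (intro ennreal_leI) (simp add: power_mult_distrib distrib_right)
      finally show "(\<integral>\<^sup>+D. ennreal ((est D k j - f k $ j)\<^sup>2) \<partial>sample_law p \<sigma> n f) \<le> ennreal ((M + 4) * \<rho>\<^sup>2)" .
    qed
    also have "\<dots> = ennreal (\<Sum>k\<in>G. \<Sum>j\<in>(UNIV :: 2 set). (M + 4) * \<rho>\<^sup>2)"
      using M by (simp add: sum_ennreal sum_nonneg del: sum_constant)
    \<comment> \<open>The number of grid points cancels the factor \<open>\<rho>\<^sup>2\<close> of
      the error at one point. The final \<open>\<rho>\<^sup>2\<close> comes from the area of the
      balls, which sits in \<open>K\<close>.\<close>
    also have "\<dots> \<le> ennreal (2 * (M + 4))"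
    proof (intro ennreal_leI)
      have "(\<Sum>k\<in>G. \<Sum>j\<in>(UNIV :: 2 set). (M + 4) * \<rho>\<^sup>2) = 2 * (M + 4) * (real (card G) * \<rho>\<^sup>2)"
        by simp
      also have "\<dots> \<le> 2 * (M + 4) * 1"
        using M card_G by (intro mult_left_mono) auto
      finally show "(\<Sum>k\<in>G. \<Sum>j\<in>(UNIV :: 2 set). (M + 4) * \<rho>\<^sup>2) \<le> 2 * (M + 4)"
        by simp
    qed
    finally have expect: "(\<integral>\<^sup>+D. ennreal (dist2 D f) \<partial>sample_law p \<sigma> n f) \<le> ennreal (2 * (M + 4))" .
    have d_nonneg: "0 \<le> dist2 D f" for D
      by (simp add: dist2_def sum_nonneg)
    have "inverse_risk (\<lambda>z. z\<^sup>2) p \<sigma> c n g f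
      \<le> (\<integral>\<^sup>+D. ennreal (72 * K) + ennreal (6 * K) * ennreal (dist2 D f) \<partial>sample_law p \<sigma> n f)"
      unfolding inverse_risk_def
    proof (intro nn_integral_mono)
      fix D
      have "(L2_norm_on (PX p) (\<lambda>x. g D x - f x))\<^sup>2
        + (L2_norm_on (PX p) (\<lambda>y. quasi_inverse c (g D) y - the_inv_into I2 f y))\<^sup>2
        \<le> ennreal (1088 * B * \<rho>\<^sup>2 * (\<Sum>k\<in>G. (norm (g D k - f k))\<^sup>2 + 64 * \<rho>\<^sup>2))"
        using \<rho> by (intro inverse_loss_le_grid_loss[OF p_meas p_le B f _ G(1) G_I2 G(3)])
          (auto simp: g_def e_class)
      also have "\<dots> \<le> ennreal (K * (72 + 6 * dist2 D f))"
        unfolding K_def[symmetric] by (intro ennreal_leI mult_left_mono sum_le K)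
      also have "\<dots> = ennreal (72 * K) + ennreal (6 * K) * ennreal (dist2 D f)"
        using K d_nonneg[of D] by (simp add: distrib_left mult_ac flip: ennreal_mult ennreal_plus)
      finally show "(L2_norm_on (PX p) (\<lambda>x. g D x - f x))\<^sup>2
        + (L2_norm_on (PX p) (\<lambda>y. quasi_inverse c (g D) y - the_inv_into I2 f y))\<^sup>2
        \<le> ennreal (72 * K) + ennreal (6 * K) * ennreal (dist2 D f)" .
    qed
    also have "\<dots> = ennreal (72 * K) + ennreal (6 * K) * (\<integral>\<^sup>+D. ennreal (dist2 D f) \<partial>sample_law p \<sigma> n f)"
      using d_meas prob_space.emeasure_space_1[OF law] by (simp add: nn_integral_add nn_integral_cmult)
    also have "\<dots> \<le> ennreal (72 * K) + ennreal (6 * K) * ennreal (2 * (M + 4))"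
      by (intro add_mono mult_left_mono expect) simp_all
    also have "\<dots> = ennreal (72 * K + 6 * K * (2 * (M + 4)))"
      using K M by (simp flip: ennreal_mult ennreal_plus)
    also have "72 * K + 6 * K * (2 * (M + 4)) = 1088 * B * (72 + 12 * (M + 4)) * \<rho>\<^sup>2"
      by (simp add: K_def algebra_simps)
    finally show ?thesis .
  qed
  ultimately show ?thesis
    using that by blast
qed

section \<open>Choice of the scale and the resulting rate\<close>

theorem proposition10:
  fixes p :: "real^2 \<Rightarrow> real" and \<sigma> :: real and c :: "real^2"
    and f1 :: "nat \<Rightarrow> estimator" and C \<alpha> :: real and \<delta> :: "nat \<Rightarrow> real"
  assumes p_meas: "p \<in> borel_measurable (restrict_space borel I2)"
    and p_pos: "\<And>x. x \<in> I2 \<Longrightarrow> 0 < p x"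
    and p_bounded: "bounded (p ` I2)"
    and p_prob: "prob_space (PX p)"
    and \<sigma>_pos: "0 < \<sigma>"
    and c_outside: "c \<notin> I2"
    and f1_estimator: "\<And>n. f1 n \<in> estimators n"
    and f1_range: "\<And>n D x. D \<in> space (PiM {1..n} (\<lambda>_. obs_algebra)) \<Longrightarrow> x \<in> I2 \<Longrightarrow> f1 n D x \<in> I2"
    and C_pos: "0 < C"
    and \<alpha>_pos: "0 < \<alpha>"
    and \<delta>_decreasing: "decseq \<delta>"
    and \<delta>_tendsto: "\<delta> \<longlonglongrightarrow> 0"
    and f1_rate: "\<forall>\<^sub>F n in sequentially. \<forall>f \<in> F_INV \<inter> F_Lip (2 powr (1/4)).
       sample_prob p \<sigma> n f
         (\<lambda>D. Linf_norm (\<lambda>x. f1 n D x - f x)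
                \<le> ennreal (C * real n powr (- 1 / (2 + 2)) * ln (real n) powr \<alpha>))
       \<ge> 1 - \<delta> n"
  shows "\<forall>\<beta>>0. \<exists>Cbar>0. \<forall>\<^sub>F n in sequentially.
     (INF g \<in> estimators n. SUP f \<in> F_INV \<inter> F_Lip (2 powr (1/4)).
        inverse_risk (\<lambda>z. z\<^sup>2) p \<sigma> c n g f)
     \<le> ennreal (Cbar * real n powr (- 2 / (2 + 2)) * ln (real n) powr (2 * \<alpha> + 2 * \<beta>))"
proof (intro allI impI)
  fix \<beta> :: real assume \<beta>: "0 < \<beta>"
  obtain B where B: "0 < B" "\<And>x. x \<in> I2 \<Longrightarrow> p x \<le> B"
  proof -
    obtain b where "\<And>x. x \<in> I2 \<Longrightarrow> \<bar>p x\<bar> \<le> b"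
      using p_bounded by (auto simp: bounded_iff)
    then show ?thesis
      using that[of "\<bar>b\<bar> + 1"] by force
  qed
  define \<kappa> where "\<kappa> = exp (1 / \<sigma>\<^sup>2) / \<sigma>\<^sup>2"
  \<comment> \<open>The two-point bound reads ln (9/4) \<le> \<kappa> n q \<rho>^2 for the mass q of
    a ball. Solving for 1/(n q) and multiplying by 1 + \<sigma>^2 bounds the variance by
    \<open>M * \<rho>\<^sup>2\<close>.\<close>
  define M where "M = (1 + \<sigma>\<^sup>2) * \<kappa> / ln (9/4)"
  define Cbar where "Cbar = 1088 * B * (72 + 12 * (M + 4))"
  have \<kappa>: "0 < \<kappa>"
    using \<sigma>_pos by (simp add: \<kappa>_def)
  have ln_pos: "0 < ln (9/4 :: real)"
    by simp
  have M: "0 < M"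
    using \<kappa> ln_pos by (auto simp: M_def intro!: divide_pos_pos mult_pos_pos add_pos_nonneg)
  have Cbar: "0 < Cbar"
    using B M by (simp add: Cbar_def)
  \<comment> \<open>The target scale is the rate of the given estimator without its constant
    \<open>C\<close>, enlarged by the logarithmic factor with exponent \<beta>.\<close>
  define R where "R n = real n powr (- 1 / 4) * ln (real n) powr (\<alpha> + \<beta>)" for n
  have "R \<longlonglongrightarrow> 0"
    unfolding R_def by real_asymp
  then have ev_R: "\<forall>\<^sub>F n in sequentially. R n < 1"
    by (rule order_tendstoD) simp
  have "filterlim (\<lambda>n. ln (real n) powr \<beta>) at_top sequentially"
    using \<beta> by real_asymp
  \<comment> \<open>The bump of height \<open>\<rho> / 10\<close> must exceed \<open>2 * r\<close>,
    and \<rho> may be as small as \<open>R n / 2\<close>; hence the factor 40. The summand 1 makes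
    the inequality strict.\<close>
  then have ev_ln: "\<forall>\<^sub>F n in sequentially. 40 * C + 1 \<le> ln (real n) powr \<beta>"
    by (auto simp: filterlim_at_top)
  have ev_\<delta>: "\<forall>\<^sub>F n in sequentially. \<delta> n < 1/4"
    using \<delta>_tendsto by (rule order_tendstoD) simp
  have "\<forall>\<^sub>F n in sequentially.
     (INF g \<in> estimators n. SUP f \<in> inv_class. inverse_risk (\<lambda>z. z\<^sup>2) p \<sigma> c n g f)
     \<le> ennreal (Cbar * real n powr (- 2 / (2 + 2)) * ln (real n) powr (2 * \<alpha> + 2 * \<beta>))"
    using f1_rate ev_R ev_ln ev_\<delta> eventually_gt_at_top[of 1]
  proof eventually_elim
    case (elim n)
    have ln_n: "0 < ln (real n)" and n: "0 < n"
      using elim by auto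
    have R_pos: "0 < R n"
      using ln_n n by (simp add: R_def)
    \<comment> \<open>The reciprocal scale is rounded up to an integer so that the grid fits the
      square exactly. As \<open>1 / R n > 1\<close>, rounding at most doubles it, so \<rho> stays
      between \<open>R n / 2\<close> and \<open>R n\<close>.\<close>
    define m where "m = nat \<lceil>1 / R n\<rceil>"
    define \<rho> where "\<rho> = 1 / real m"
    have R_inv: "1 < 1 / R n"
      using R_pos elim by simp
    then have m: "1 / R n \<le> real m" "real m \<le> 2 * (1 / R n)" "0 < m"
      unfolding m_def by linarith+
    have \<rho>: "0 < \<rho>" "\<rho> \<le> 1" "\<rho> \<le> R n" "R n / 2 \<le> \<rho>"
      using m R_pos by (simp_all add: \<rho>_def field_simps)
    obtain G where G: "finite G" "card G \<le> m * m" "\<And>k. k \<in> G \<Longrightarrow> cball k \<rho> \<subseteq> I2"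
      "\<And>x. x \<in> I2 \<Longrightarrow> \<exists>k\<in>G. norm (x - k) \<le> 2 * \<rho>"
      using I2_grid[OF m(3) \<rho>_def] by metis
    have "real (card G) * \<rho>\<^sup>2 \<le> real (m * m) * \<rho>\<^sup>2"
      using G(2) by (intro mult_right_mono of_nat_mono) auto
    also have "\<dots> = 1"
      using m(3) by (simp add: \<rho>_def power2_eq_square)
    finally have card_G: "real (card G) * \<rho>\<^sup>2 \<le> 1" .
    define r where "r = C * real n powr (- 1 / (2 + 2)) * ln (real n) powr \<alpha>"
    have r: "0 \<le> r" "2 * r < \<rho> / 10"
    proof -
      show "0 \<le> r"
        using C_pos by (simp add: r_def)
      have "40 * r = (40 * C) * (real n powr (- 1 / 4) * ln (real n) powr \<alpha>)"
        by (simp add: r_def)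
      also have "\<dots> < ln (real n) powr \<beta> * (real n powr (- 1 / 4) * ln (real n) powr \<alpha>)"
        using elim ln_n n by (intro mult_strict_right_mono) auto
      also have "\<dots> = R n"
        by (simp add: R_def powr_add)
      finally show "2 * r < \<rho> / 10"
        using \<rho> by linarith
    qed
    \<comment> \<open>Here the given estimator enters, with \<delta> below 1/4 for the current
      n.\<close>
    have rate: "sample_prob p \<sigma> n f (\<lambda>D. Linf_norm (\<lambda>x. f1 n D x - f x) \<le> ennreal r) \<ge> 3/4"
      if "f \<in> inv_class" for f
      using bspec[OF elim(1) that[unfolded inv_class_def]] elim(4) unfolding r_def by linarith
    have mass: "ln (9/4) \<le> \<kappa> * (n * measure (PX p) (cball k \<rho>) * \<rho>\<^sup>2)" if "k \<in> G" for k
      unfolding \<kappa>_def by (rule ball_mass_lower_bound[OF p_prob \<sigma>_pos rate G(3)[OF that] \<rho>(1,2) r])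
    have mass_pos: "0 < measure (PX p) (cball k \<rho>)" if "k \<in> G" for k
    proof (rule ccontr)
      assume "\<not> 0 < measure (PX p) (cball k \<rho>)"
      then have "measure (PX p) (cball k \<rho>) = 0"
        using measure_nonneg[of "PX p" "cball k \<rho>"] by linarith
      then show False
        using mass[OF that] ln_pos by simp
    qed
    have var: "(1 + \<sigma>\<^sup>2) / (n * measure (PX p) (cball k \<rho>)) \<le> M * \<rho>\<^sup>2" if "k \<in> G" for k
    proof -
      define q where "q = n * measure (PX p) (cball k \<rho>)"
      have q: "0 < q"
        using mass_pos[OF that] n by (simp add: q_def)
      have "(1 + \<sigma>\<^sup>2) * ln (9/4) \<le> (1 + \<sigma>\<^sup>2) * (\<kappa> * (q * \<rho>\<^sup>2))"
        using mass[OF that] unfolding q_def by (intro mult_left_mono) auto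
      then have "(1 + \<sigma>\<^sup>2) / q \<le> M * \<rho>\<^sup>2"
        using q ln_pos by (simp add: M_def pos_divide_le_eq pos_le_divide_eq mult_ac del: ln_div)
      then show ?thesis
        by (simp add: q_def)
    qed
    obtain g where g: "g \<in> estimators n"
      "\<And>f. f \<in> inv_class \<Longrightarrow> inverse_risk (\<lambda>z. z\<^sup>2) p \<sigma> c n g f \<le> ennreal (Cbar * \<rho>\<^sup>2)"
      using grid_estimator_risk[OF p_meas B(2) less_imp_le[OF B(1)] p_prob \<sigma>_pos n \<rho>(1) G(1,3,4) card_G
          mass_pos var less_imp_le[OF M], of c] unfolding Cbar_def by metis
    have "(INF g \<in> estimators n. SUP f \<in> inv_class. inverse_risk (\<lambda>z. z\<^sup>2) p \<sigma> c n g f)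
      \<le> (SUP f \<in> inv_class. inverse_risk (\<lambda>z. z\<^sup>2) p \<sigma> c n g f)"
      using g(1) by (intro INF_lower)
    also have "\<dots> \<le> ennreal (Cbar * \<rho>\<^sup>2)"
      by (intro SUP_least g(2))
    also have "\<dots> \<le> ennreal (Cbar * (R n)\<^sup>2)"
      using Cbar \<rho> by (intro ennreal_leI mult_left_mono power_mono) auto
    also have "Cbar * (R n)\<^sup>2 = Cbar * real n powr (- 2 / (2 + 2)) * ln (real n) powr (2 * \<alpha> + 2 * \<beta>)"
      by (simp add: R_def power2_eq_square mult_ac flip: powr_add)
    finally show ?case .
  qed
  then show "\<exists>Cbar>0. \<forall>\<^sub>F n in sequentially.
     (INF g \<in> estimators n. SUP f \<in> F_INV \<inter> F_Lip (2 powr (1/4)). inverse_risk (\<lambda>z. z\<^sup>2) p \<sigma> c n g f)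
     \<le> ennreal (Cbar * real n powr (- 2 / (2 + 2)) * ln (real n) powr (2 * \<alpha> + 2 * \<beta>))"
    using Cbar unfolding inv_class_def by blast
qed

end
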